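(* Suppose that $V=V_4$ (i.e. $V_1=V_2=V_3=\emptyset$), that $\mathbf X=[\mathbb R^m]^{|V|}$, $\bar E=E\times\{1,\dots,m\}$ and the subspaces $H_{((i,j),k)}$ are those of a connected undirected graph $G=(V,E)$ as described in the context, and that for every $i\in V$ the conjugate $f_i^*$ is strongly convex with modulus $\sigma>0$ (equivalently, $f_i$ is differentiable and $\nabla f_i$ is Lipschitz with constant $1/\sigma$). Let the sequences $\mathbf z^{n,w}=\{\mathbf z^{n,w}_\alpha\}_{\alpha\in V\cup\bar E}$ and the functions $\mathbf f_{i,n,w}$ be generated by the distributed Dykstra's algorithm, with the assumptions (A1)-(A3) of the context. Suppose $S_{n,1}=V$ for all $n\ge1$, $\bigcup_{w=1}^{\bar w}S_{n,w}\cap\bar E=\bar E_n$ for all $n\ge1$, and that $\mathbf z^*$ is a minimizer of $F_S$. Then there is some $c\in(0,1)$ such that for all $n\ge1$ $$\tilde F_S^{n+1,0}(\mathbf z^{n+1,0})-F_S(\mathbf z^* )\le c\,\bigl[\tilde F_S^{n,0}(\mathbf z^{n,0})-F_S(\mathbf z^* )\bigr].$$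
   Context: **Problem.** $V,\bar E$ are finite disjoint sets and $\mathbf X=\prod_{i\in V}X_i$ with each $X_i$ a finite dimensional Hilbert space; $[\mathbf x]_i\in X_i$ is the $i$-th component of $\mathbf x\in\mathbf X$. For $i\in V$, $f_i:X_i\to\mathbb R\cup\{\infty\}$ is closed convex and $\mathbf f_i(\mathbf x)=f_i([\mathbf x]_i)$. For $\alpha\in\bar E$, $H_\alpha\subset\mathbf X$ is a linear subspace and $\mathbf f_\alpha=\delta_{H_\alpha}$ (indicator function). Fix $\bar{\mathbf x}\in\mathbf X$. The primal problem is $\min_{\mathbf x\in\mathbf X}\frac12\|\mathbf x-\bar{\mathbf x}\|^2+\sum_{\alpha\in V\cup\bar E}\mathbf f_\alpha(\mathbf x)$. The set $V$ is partitioned as $V_1\cup V_2\cup V_3\cup V_4$; for $i\in V_4$, $\mathrm{dom}(f_i)=X_i$ and $f_i$ is accessed through subgradients (here $V=V_4$). $^*$ denotes Fenchel conjugate. **Graph setting.** $G=(V,E)$ is a connected undirected graph, $X_i=\mathbb R^m$ for all $i\in V$, $\bar E=E\times\{1,\dots,m\}$, and $H_{((i,j),k)}=\{\mathbf x\in\mathbf X:[[\mathbf x]_i]_k=[[\mathbf x]_j]_k\}$, where $[[\mathbf x]_i]_k$ is the $k$-th coordinate of $[\mathbf x]_i\in\mathbb R^m$. **Objective functions.** For $\mathbf z=\{\mathbf z_\alpha\}_{\alpha\in V\cup\bar E}\in\mathbf X^{|V\cup\bar E|}$, $F_S(\mathbf z)=\sum_{i\in V}\mathbf f_i^*(\mathbf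 z_i)+\sum_{\alpha\in\bar E}\delta_{H_\alpha}^*(\mathbf z_\alpha)+\frac12\|\bar{\mathbf x}-\sum_{\alpha\in V\cup\bar E}\mathbf z_\alpha\|^2$, and $\tilde F_S^{n,w}(\mathbf z)=\sum_{i\in V}\mathbf f_{i,n,w}^*(\mathbf z_i)+\sum_{\alpha\in\bar E}\delta_{H_\alpha}^*(\mathbf z_\alpha)+\frac12\|\bar{\mathbf x}-\sum_{\alpha\in V\cup\bar E}\mathbf z_\alpha\|^2$, with $\mathbf f_{i,n,w}$ from the algorithm below. **Connecting sets.** $D=\bigcap_{\alpha\in\bar E}H_\alpha$. A subset $E'\subset\bar E$ connects $V$ if $\bigcap_{\alpha\in E'}H_\alpha=D$. $C_{reg}>0$ is a constant such that for all $\mathbf v\in D^\perp$ and all $E'$ connecting $V$ one can write $\mathbf v=\sum_{\alpha\in E'}\mathbf v_\alpha$ with $\mathbf v_\alpha\in H_\alpha^\perp$ and $\|\mathbf v_\alpha\|\le C_{reg}\|\mathbf v\|$ (such a constant exists). **Distributed Dykstra's algorithm.** $\bar w$ is a fixed positive integer. For $\alpha\in(\bar E\cup V)\setminus V_4$ put $\mathbf f_{\alpha,n,w}=\mathbf f_\alpha$ for all $n,w$. Write $\mathbf v_H^{n,w}=\sum_{\alpha\in\bar E}\mathbf z_\alpha^{n,w}$, $\mathbf v_A^{n,w}=\mathbf v_H^{n,w}+\sum_{i\in V}\mathbf z_i^{n,w}$, $\mathbf x^{n,w}=\bar{\mathbf x}-\mathbf v_A^{n,w}$. Initialization: choose $\mathbf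 z_i^{1,0}\in\mathbf X$ with $[\mathbf z_i^{1,0}]_j=0$ for $j\ne i$ ($i\in V$); $\mathbf v_H^{1,0}\in D^\perp$; and for $i\in V_4$ a convex function $f_{i,1,0}:X_i\to\mathbb R$ with $f_{i,1,0}\le f_i$, and $\mathbf f_{i,1,0}(\mathbf x)=f_{i,1,0}([\mathbf x]_i)$. For $n=1,2,\dots$: (a) Choose $\bar E_n\subset\bar E$ that connects $V$, and choose $\{\mathbf z_\alpha^{n,0}\}_{\alpha\in\bar E}$ with $\mathbf z_\alpha^{n,0}=0$ for $\alpha\notin\bar E_n$, $\mathbf z_\alpha^{n,0}\in H_\alpha^\perp$ and $\|\mathbf z_\alpha^{n,0}\|\le C_{reg}\|\mathbf v_H^{n,0}\|$ for all $\alpha\in\bar E$, and $\sum_{\alpha\in\bar E}\mathbf z_\alpha^{n,0}=\mathbf v_H^{n,0}$. (b) For $w=1,\dots,\bar w$: choose a nonempty $S_{n,w}\subset\bar E_n\cup V$. - If $S_{n,w}\subset V_4$: for each $i\in S_{n,w}$ let $q=[\bar{\mathbf x}-\mathbf v_H^{n,w-1}-\mathbf z_i^{n,w-1}]_i$, choose $s\in\partial f_i(q)$, let $\tilde f_{i,n,w-1}(x)=f_i(q)+\langle s,x-q\rangle$, let $x_i^+$ be the minimizer over $x\in X_i$ of $\frac12\|[\bar{\mathbf x}-\mathbf v_H^{n,w-1}]_i-x\|^2+\max\{f_{i,n,w-1},\tilde f_{i,n,w-1}\}(x)$, and $z_i^+=[\bar{\mathbf x}-\mathbf v_H^{n,w-1}]_i-x_i^+$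 the corresponding dual solution. Set $f_{i,n,w}(x)=\max\{f_{i,n,w-1},\tilde f_{i,n,w-1}\}(x_i^+)+\langle x-x_i^+,z_i^+\rangle$, $\mathbf f_{i,n,w}(\mathbf x)=f_{i,n,w}([\mathbf x]_i)$, $[\mathbf z_i^{n,w}]_i=z_i^+$ and $[\mathbf z_i^{n,w}]_j=0$ for $j\ne i$. For $i\in V_4\setminus S_{n,w}$ set $\mathbf f_{i,n,w}=\mathbf f_{i,n,w-1}$. - Otherwise: set $\mathbf f_{i,n,w}=\mathbf f_{i,n,w-1}$ for all $i\in V_4$, and let $\{\mathbf z_\alpha^{n,w}\}_{\alpha\in S_{n,w}}$ be a minimizer of $\frac12\|\bar{\mathbf x}-\sum_{\alpha\notin S_{n,w}}\mathbf z_\alpha^{n,w-1}-\sum_{\alpha\in S_{n,w}}\mathbf z_\alpha\|^2+\sum_{\alpha\in S_{n,w}}\mathbf f_{\alpha,n,w}^*(\mathbf z_\alpha)$. In both cases $\mathbf z_\alpha^{n,w}=\mathbf z_\alpha^{n,w-1}$ for $\alpha\notin S_{n,w}$. (c) Set $\mathbf z_i^{n+1,0}=\mathbf z_i^{n,\bar w}$ ($i\in V$), $\mathbf v_H^{n+1,0}=\mathbf v_H^{n,\bar w}$, and $\mathbf f_{i,n+1,0}=\mathbf f_{i,n,\bar w}$ ($i\in V_4$). **Assumptions on the algorithm.** Let $p(n,\alpha)=\max\{w'\le\bar w:\alpha\in S_{n,w'}\}$. (A1) Whenever $w>1$ and $S_{n,w}\subset V_4$, for each $i\in V_4$ the vector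 $[\mathbf z_i^{n,w-1}]_i$ is the minimizer over $z\in X_i$ of $\frac12\|[\bar{\mathbf x}-\mathbf v_H^{n,w-1}]_i-z\|^2+f_{i,n,w-1}^*(z)$; in other words, if $w_i$ is the last index $w'\in\{1,\dots,w-1\}$ with $i\in S_{n,w'}$, then for all $\tilde w\in\{w_i+1,\dots,w-1\}$ and $\alpha\in S_{n,\tilde w}\cap\bar E$, $\mathbf v\in H_\alpha^\perp$ implies $[\mathbf v]_i=0$. (A2) For all $i\in V_4$, $\tilde w\in\{p(n,i)+1,\dots,\bar w\}$ and $\alpha\in S_{n,\tilde w}\cap\bar E$, $\mathbf v\in H_\alpha^\perp$ implies $[\mathbf v]_i=0$. (A3) $S_{n,1}=V_4$ for all $n>1$. *)

theory Defs
  imports "HOL-Analysis.Analysis"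
begin

section \<open>Convex analysis\<close>

definition fenchel_conj :: "('a::real_inner \<Rightarrow> ereal) \<Rightarrow> 'a \<Rightarrow> ereal" where
  "fenchel_conj g y = (SUP x. ereal (y \<bullet> x) - g x)"

definition indicator_fun :: "'a set \<Rightarrow> 'a \<Rightarrow> ereal" where
  "indicator_fun S x = (if x \<in> S then 0 else \<infinity>)"

definition subdifferential :: "('a::real_inner \<Rightarrow> real) \<Rightarrow> 'a \<Rightarrow> 'a set" where
  "subdifferential f q = {s. \<forall>x. f q + s \<bullet> (x - q) \<le> f x}"

definition strongly_convex :: "real \<Rightarrow> ('a::real_inner \<Rightarrow> ereal) \<Rightarrow> bool" where
  "strongly_convex \<sigma> g \<longleftrightarrow>
     (\<forall>x y. \<forall>t\<in>{0<..<1}.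
        g ((1 - t) *\<^sub>R x + t *\<^sub>R y) + ereal (\<sigma> / 2 * t * (1 - t) * (norm (x - y))\<^sup>2)
          \<le> ereal (1 - t) * g x + ereal t * g y)"

definition minimizes :: "'a \<Rightarrow> ('a \<Rightarrow> 'b::linorder) \<Rightarrow> bool" (infix "minimizes" 50) where
  "x minimizes h \<longleftrightarrow> is_arg_min h (\<lambda>_. True) x"


section \<open>The graph and the subspaces\<close>

text \<open>The vertex set is the finite type \<open>'v\<close>, and an undirected edge is a two-element
  set of vertices. The product space is \<open>real ^ 'm ^ 'v\<close>, with its Euclidean norm.\<close>

definition connected_ugraph :: "'v set set \<Rightarrow> bool" where
  "connected_ugraph E \<longleftrightarrow>
     (\<forall>e\<in>E. card e = 2) \<and> (\<forall>i j. (i, j) \<in> {(u, v). {u, v} \<in> E}\<^sup>*)"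

definition Ebar :: "'v set set \<Rightarrow> ('v set \<times> 'm) set" where
  "Ebar E = E \<times> UNIV"

definition H :: "'v::finite set \<times> 'm::finite \<Rightarrow> (real ^ 'm ^ 'v) set" where
  "H \<alpha> = {x. \<forall>i\<in>fst \<alpha>. \<forall>j\<in>fst \<alpha>. x $ i $ snd \<alpha> = x $ j $ snd \<alpha>}"

definition D :: "'v::finite set set \<Rightarrow> (real ^ 'm::finite ^ 'v) set" where
  "D E = (\<Inter>\<alpha>\<in>Ebar E. H \<alpha>)"

definition connects :: "'v::finite set set \<Rightarrow> ('v set \<times> 'm::finite) set \<Rightarrow> bool" where
  "connects E E' \<longleftrightarrow> E' \<subseteq> Ebar E \<and> (\<Inter>\<alpha>\<in>E'. H \<alpha>) = (D E :: (real ^ 'm ^ 'v) set)"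

definition regularity_const :: "('v::finite set \<times> 'm::finite) itself \<Rightarrow> 'v set set \<Rightarrow> real \<Rightarrow> bool" where
  "regularity_const _ E C \<longleftrightarrow> C > 0 \<and>
     (\<forall>v \<in> (D E :: (real ^ 'm ^ 'v) set)\<^sup>\<bottom>. \<forall>E'. connects E E' \<longrightarrow>
        (\<exists>u. v = (\<Sum>\<alpha>\<in>E'. u \<alpha>) \<and> (\<forall>\<alpha>\<in>E'. u \<alpha> \<in> (H \<alpha>)\<^sup>\<bottom> \<and> norm (u \<alpha>) \<le> C * norm v)))"


section \<open>Dual objective functions\<close>

text \<open>The disjoint union of the vertices and \<open>Ebar E\<close> is encoded in a sum type: \<open>Inl i\<close> is the
  vertex \<open>i\<close>, and \<open>Inr (e, k)\<close> is the \<open>k\<close>-th coordinate constraint along the edge \<open>e\<close>.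
  Entries of a family at \<open>Inr \<alpha>\<close> with \<open>\<alpha>\<close> outside \<open>Ebar E\<close> carry no meaning.\<close>

type_synonym ('v, 'm) idx = "'v + 'v set \<times> 'm"

abbreviation vertices :: "('v, 'm) idx set" where
  "vertices \<equiv> range Inl"

definition indices :: "'v set set \<Rightarrow> ('v, 'm) idx set" where
  "indices E = vertices \<union> Inr ` Ebar E"

fun bold :: "('v::finite \<Rightarrow> real ^ 'm::finite \<Rightarrow> real) \<Rightarrow> ('v, 'm) idx \<Rightarrow> real ^ 'm ^ 'v \<Rightarrow> ereal" where
  "bold g (Inl i) = (\<lambda>x. ereal (g i (x $ i)))"
| "bold g (Inr \<alpha>) = indicator_fun (H \<alpha>)"

text \<open>With \<open>g\<close> the given functions this is $F_S$; with \<open>g\<close> the current minorants it is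
  $\tilde F_S^{n,w}$.\<close>

definition dual_obj ::
  "'v::finite set set \<Rightarrow> real ^ 'm::finite ^ 'v \<Rightarrow> ('v \<Rightarrow> real ^ 'm \<Rightarrow> real)
    \<Rightarrow> (('v, 'm) idx \<Rightarrow> real ^ 'm ^ 'v) \<Rightarrow> ereal" where
  "dual_obj E xbar g z =
     (\<Sum>i\<in>UNIV. fenchel_conj (bold g (Inl i)) (z (Inl i)))
   + (\<Sum>\<alpha>\<in>Ebar E. fenchel_conj (indicator_fun (H \<alpha>)) (z (Inr \<alpha>)))
   + ereal (1/2 * (norm (xbar - (\<Sum>\<alpha>\<in>indices E. z \<alpha>)))\<^sup>2)"


section \<open>The distributed Dykstra algorithm with all functions treated by subgradients\<close>

definition vH :: "'v::finite set set \<Rightarrow> (('v, 'm::finite) idx \<Rightarrow> real ^ 'm ^ 'v) \<Rightarrow> real ^ 'm ^ 'v" where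
  "vH E z = (\<Sum>\<alpha>\<in>Ebar E. z (Inr \<alpha>))"

text \<open>One vertex update. Here \<open>c\<close> is $[\bar x - v_H]_i$, \<open>\<phi>\<close> and \<open>z\<close> are the current minorant of
  \<open>f\<close> and the current $i$-th component of $z_i$, and \<open>\<phi>'\<close> and \<open>z'\<close> are the new ones.\<close>

definition subgradient_update ::
  "('a::real_inner \<Rightarrow> real) \<Rightarrow> 'a \<Rightarrow> ('a \<Rightarrow> real) \<Rightarrow> 'a \<Rightarrow> ('a \<Rightarrow> real) \<Rightarrow> 'a \<Rightarrow> bool" where
  "subgradient_update f c \<phi> z \<phi>' z' \<longleftrightarrow>
     (let q = c - z in
      \<exists>s \<in> subdifferential f q. \<exists>xp.
        let h = (\<lambda>x. max (\<phi> x) (f q + s \<bullet> (x - q))) in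
        xp minimizes (\<lambda>x. 1/2 * (norm (c - x))\<^sup>2 + h x) \<and>
        z' = c - xp \<and>
        \<phi>' = (\<lambda>x. h xp + (x - xp) \<bullet> z'))"

definition block_obj ::
  "'v::finite set set \<Rightarrow> real ^ 'm::finite ^ 'v \<Rightarrow> ('v \<Rightarrow> real ^ 'm \<Rightarrow> real) \<Rightarrow> ('v, 'm) idx set
    \<Rightarrow> (('v, 'm) idx \<Rightarrow> real ^ 'm ^ 'v) \<Rightarrow> (('v, 'm) idx \<Rightarrow> real ^ 'm ^ 'v) \<Rightarrow> ereal" where
  "block_obj E xbar g S zold y =
     ereal (1/2 * (norm (xbar - (\<Sum>\<alpha>\<in>indices E - S. zold \<alpha>) - (\<Sum>\<alpha>\<in>S. y \<alpha>)))\<^sup>2)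
   + (\<Sum>\<alpha>\<in>S. fenchel_conj (bold g \<alpha>) (y \<alpha>))"

definition inner_step ::
  "'v::finite set set \<Rightarrow> real ^ 'm::finite ^ 'v \<Rightarrow> ('v \<Rightarrow> real ^ 'm \<Rightarrow> real) \<Rightarrow> ('v, 'm) idx set
    \<Rightarrow> ('v \<Rightarrow> real ^ 'm \<Rightarrow> real) \<Rightarrow> (('v, 'm) idx \<Rightarrow> real ^ 'm ^ 'v)
    \<Rightarrow> ('v \<Rightarrow> real ^ 'm \<Rightarrow> real) \<Rightarrow> (('v, 'm) idx \<Rightarrow> real ^ 'm ^ 'v) \<Rightarrow> bool" where
  "inner_step E xbar f S g z g' z' \<longleftrightarrow>
     (if S \<subseteq> vertices then
        (\<forall>i. if Inl i \<in> S
             then subgradient_update (f i) ((xbar - vH E z) $ i) (g i) (z (Inl i) $ i)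
                    (g' i) (z' (Inl i) $ i)
                  \<and> (\<forall>j. j \<noteq> i \<longrightarrow> z' (Inl i) $ j = 0)
             else g' i = g i)
      else g' = g \<and> z' minimizes (block_obj E xbar g' S z))
     \<and> (\<forall>\<alpha> \<in> indices E - S. z' \<alpha> = z \<alpha>)"

text \<open>A run is given by the sets \<open>En n\<close> and \<open>S n w\<close>, the iterates \<open>z n w\<close> and the minorants \<open>g n w\<close>
  (for $n \ge 1$). The vector $v_H^{n,w}$ is not stored separately: it is \<open>vH E (z n w)\<close>, so the
  redistribution of $v_H^{n,0}$ at the start of cycle $n$ is expressed by
  \<open>vH E (z (n + 1) 0) = vH E (z n wbar)\<close>.\<close>

definition dykstra_run ::
  "'v::finite set set \<Rightarrow> real ^ 'm::finite ^ 'v \<Rightarrow> ('v \<Rightarrow> real ^ 'm \<Rightarrow> real) \<Rightarrow> real \<Rightarrow> nat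
    \<Rightarrow> (nat \<Rightarrow> ('v set \<times> 'm) set) \<Rightarrow> (nat \<Rightarrow> nat \<Rightarrow> ('v, 'm) idx set)
    \<Rightarrow> (nat \<Rightarrow> nat \<Rightarrow> ('v, 'm) idx \<Rightarrow> real ^ 'm ^ 'v)
    \<Rightarrow> (nat \<Rightarrow> nat \<Rightarrow> 'v \<Rightarrow> real ^ 'm \<Rightarrow> real) \<Rightarrow> bool" where
  "dykstra_run E xbar f Creg wbar En S z g \<longleftrightarrow>
     \<comment> \<open>initialization\<close>
     (\<forall>i j. j \<noteq> i \<longrightarrow> z 1 0 (Inl i) $ j = 0) \<and>
     vH E (z 1 0) \<in> (D E)\<^sup>\<bottom> \<and>
     (\<forall>i. convex_on UNIV (g 1 0 i) \<and> (\<forall>x. g 1 0 i x \<le> f i x)) \<and>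
     (\<forall>n\<ge>1.
       \<comment> \<open>step (a)\<close>
       connects E (En n) \<and>
       (\<forall>\<alpha>\<in>Ebar E. (\<alpha> \<notin> En n \<longrightarrow> z n 0 (Inr \<alpha>) = 0) \<and>
          z n 0 (Inr \<alpha>) \<in> (H \<alpha>)\<^sup>\<bottom> \<and>
          norm (z n 0 (Inr \<alpha>)) \<le> Creg * norm (vH E (z n 0))) \<and>
       \<comment> \<open>step (b)\<close>
       (\<forall>w\<in>{1..wbar}. S n w \<noteq> {} \<and> S n w \<subseteq> vertices \<union> Inr ` En n \<and>
          inner_step E xbar f (S n w) (g n (w - 1)) (z n (w - 1)) (g n w) (z n w)) \<and>
       \<comment> \<open>step (c)\<close>
       (\<forall>i. z (n + 1) 0 (Inl i) = z n wbar (Inl i)) \<and>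
       vH E (z (n + 1) 0) = vH E (z n wbar) \<and>
       g (n + 1) 0 = g n wbar)"


section \<open>Assumptions on the run\<close>

definition assumption_A1 ::
  "'v::finite set set \<Rightarrow> real ^ 'm::finite ^ 'v \<Rightarrow> nat \<Rightarrow> (nat \<Rightarrow> nat \<Rightarrow> ('v, 'm) idx set)
    \<Rightarrow> (nat \<Rightarrow> nat \<Rightarrow> ('v, 'm) idx \<Rightarrow> real ^ 'm ^ 'v)
    \<Rightarrow> (nat \<Rightarrow> nat \<Rightarrow> 'v \<Rightarrow> real ^ 'm \<Rightarrow> real) \<Rightarrow> bool" where
  "assumption_A1 E xbar wbar S z g \<longleftrightarrow>
     (\<forall>n\<ge>1. \<forall>w\<in>{2..wbar}. S n w \<subseteq> vertices \<longrightarrow>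
       (\<forall>i. (z n (w - 1) (Inl i) $ i) minimizes
              (\<lambda>y. ereal (1/2 * (norm ((xbar - vH E (z n (w - 1))) $ i - y))\<^sup>2)
                 + fenchel_conj (\<lambda>x. ereal (g n (w - 1) i x)) y)))"

text \<open>Only meaningful if \<open>\<alpha>\<close> is treated at least once in cycle \<open>n\<close>.\<close>

definition last_index :: "nat \<Rightarrow> (nat \<Rightarrow> nat \<Rightarrow> ('v, 'm) idx set) \<Rightarrow> nat \<Rightarrow> ('v, 'm) idx \<Rightarrow> nat" where
  "last_index wbar S n \<alpha> = Max {w \<in> {1..wbar}. \<alpha> \<in> S n w}"

definition assumption_A2 :: "nat \<Rightarrow> (nat \<Rightarrow> nat \<Rightarrow> ('v::finite, 'm::finite) idx set) \<Rightarrow> bool" where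
  "assumption_A2 wbar S \<longleftrightarrow>
     (\<forall>n\<ge>1. \<forall>i. \<forall>w\<in>{last_index wbar S n (Inl i) + 1..wbar}. \<forall>\<alpha>. Inr \<alpha> \<in> S n w \<longrightarrow>
       (\<forall>v \<in> (H \<alpha> :: (real ^ 'm ^ 'v) set)\<^sup>\<bottom>. v $ i = 0))"

definition assumption_A3 :: "(nat \<Rightarrow> nat \<Rightarrow> ('v, 'm) idx set) \<Rightarrow> bool" where
  "assumption_A3 S \<longleftrightarrow> (\<forall>n>1. S n 1 = vertices)"

end

theory Submission
  imports Defs
begin

text \<open>
  Let \<open>F\<close> be the optimal dual value, \<open>v\<close> the dual value at the start of a cycle and \<open>\<Delta>\<close> its decrease
  over the cycle. Everything follows from an inequality \<open>v - F \<le> K * \<Delta>\<close> with a constant \<open>K\<close> that does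
  not depend on the cycle: it makes the next gap \<open>v - F - \<Delta>\<close> at most \<open>(1 - 1 / K) * (v - F)\<close>.

  Write \<open>r\<close> for the residual, that is \<open>xbar\<close> minus the sum of all dual variables. At a point with finite
  dual value, the conjugate value \<open>b i\<close> at the vertex \<open>i\<close> provides the affine minorant
  \<open>x \<mapsto> z i \<bullet> x - b i\<close> of \<open>f i\<close>. Weak duality and a cancellation (\<open>weak_duality\<close>,
  \<open>primal_dual_gap\<close>) show that for each \<open>p\<close> in the consensus subspace \<open>D E\<close> the gap \<open>v - F\<close> is at most
  the error of these minorants at \<open>p\<close> plus \<open>(norm (p - r))\<^sup>2 / 2\<close>. Strong convexity of the conjugates
  says that \<open>f i\<close> has a Lipschitz gradient, and therefore the slope of an affine minorant differs from
  the gradient of \<open>f i\<close> by at most the order of the square root of its error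
  (\<open>affine_minorant_slope_bound\<close>). With \<open>p\<close> the projection of \<open>r\<close> to \<open>D E\<close>, the gap is thus bounded by a
  multiple of the minorant error at \<open>r\<close> and of the squared distance of \<open>r\<close> to \<open>D E\<close>. Both are bounded by
  multiples of \<open>\<Delta>\<close>.

  The minorant error: the first step of a cycle adds to every minorant a cut of \<open>f i\<close> that is exact at
  \<open>r\<close>. Since the slope error is controlled by the error itself, the cut raises the minimum of the
  proximal problem, and so lowers the dual value, by a fixed fraction of the error
  (\<open>subgradient_update_decrease_gap\<close>).

  The distance: each inner step lowers the dual value by at least half of the squared displacement of
  \<open>r\<close> (\<open>inner_step_decrease\<close>), so \<open>r\<close> moves by at most the order of \<open>sqrt \<Delta>\<close> during the cycle. Just
  after an edge constraint is treated, \<open>r\<close> lies in its subspace. Hence at the start of the cycle \<open>r\<close> was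
  within the order of \<open>sqrt \<Delta>\<close> of each subspace of a connecting family, and regularity turns this into a
  bound for the distance to \<open>D E\<close> (\<open>near_consensus\<close>).

  Before the first cycle the dual value may be infinite, and then the claimed inequality is trivial;
  from the end of the first cycle on it is finite.
\<close>

section \<open>Conjugates of real-valued convex functions\<close>

lemma minimizes_iff: "x minimizes h \<longleftrightarrow> (\<forall>y. h x \<le> h y)"
  by (simp add: minimizes_def is_arg_min_linorder)

lemma fenchel_conj_le_iff:
  "fenchel_conj (\<lambda>x. ereal (\<phi> x)) y \<le> ereal b \<longleftrightarrow> (\<forall>x. y \<bullet> x - \<phi> x \<le> b)"
  by (simp add: fenchel_conj_def SUP_le_iff)

lemma fenchel_young: "ereal (y \<bullet> x) - g x \<le> fenchel_conj g y"
  unfolding fenchel_conj_def by (rule SUP_upper) simp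

lemma fenchel_young_real: "ereal (y \<bullet> x - \<phi> x) \<le> fenchel_conj (\<lambda>x. ereal (\<phi> x)) y"
  using fenchel_young[of y x "\<lambda>x. ereal (\<phi> x)"] by simp

lemma fenchel_conj_subgradient:
  assumes "s \<in> subdifferential \<phi> q"
  shows "fenchel_conj (\<lambda>x. ereal (\<phi> x)) s = ereal (s \<bullet> q - \<phi> q)"
proof (rule antisym)
  show "fenchel_conj (\<lambda>x. ereal (\<phi> x)) s \<le> ereal (s \<bullet> q - \<phi> q)"
    unfolding fenchel_conj_le_iff
  proof
    fix x
    have "\<phi> q + s \<bullet> (x - q) \<le> \<phi> x"
      using assms by (simp add: subdifferential_def)
    then show "s \<bullet> x - \<phi> x \<le> s \<bullet> q - \<phi> q"
      by (simp add: inner_diff_right)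
  qed
qed (rule fenchel_young_real)

text \<open>This is how first-order conditions are extracted: comparing with the point at parameter \<open>t\<close> on a
segment and dividing by \<open>t\<close> leaves an error term that is linear in \<open>t\<close>.\<close>
lemma le_of_le_add_small_multiple:
  fixes a b c :: real
  assumes "\<And>t. 0 < t \<Longrightarrow> t < 1 \<Longrightarrow> a \<le> b + t * c"
  shows "a \<le> b"
proof (rule tendsto_lowerbound)
  have "((\<lambda>t. b + t * c) \<longlongrightarrow> b + 0 * c) (at_right 0)"
    by (intro tendsto_intros)
  then show "((\<lambda>t. b + t * c) \<longlongrightarrow> b) (at_right (0::real))"
    by simp
  show "\<forall>\<^sub>F t in at_right 0. a \<le> b + t * c"
    using assms by (auto simp: eventually_at_right_field intro!: exI[of _ 1])
qed simp

text \<open>Separate the point \<open>(q, f q)\<close> from the strict epigraph. The normalized normal vector of the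
separating hyperplane is the subgradient.\<close>
lemma convex_real_has_subgradient:
  fixes f :: "'a::euclidean_space \<Rightarrow> real"
  assumes "convex_on UNIV f"
  obtains s where "s \<in> subdifferential f q"
proof -
  let ?T = "{p::'a \<times> real. f (fst p) < snd p}"
  have "convex ?T"
  proof (rule convexI)
    fix p r :: "'a \<times> real" and u v :: real
    assume *: "p \<in> ?T" "r \<in> ?T" "0 \<le> u" "0 \<le> v" "u + v = 1"
    have "f (u *\<^sub>R fst p + v *\<^sub>R fst r) \<le> u * f (fst p) + v * f (fst r)"
      using assms * by (auto simp: convex_on_def)
    also have "\<dots> < u * snd p + v * snd r"
    proof (cases "u = 0")
      case True
      then show ?thesis using * by simp
    next
      case False
      then have "u * f (fst p) < u * snd p" "v * f (fst r) \<le> v * snd r"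
        using * by (auto intro: mult_left_mono)
      then show ?thesis by simp
    qed
    finally show "u *\<^sub>R p + v *\<^sub>R r \<in> ?T" by simp
  qed
  moreover have "(q, f q + 1) \<in> ?T" by simp
  then have "?T \<noteq> {}" by blast
  ultimately obtain w d where w: "w \<noteq> 0" "w \<bullet> (q, f q) \<le> d" "\<And>p. p \<in> ?T \<Longrightarrow> d \<le> w \<bullet> p"
    using separating_hyperplane_sets[of "{(q, f q)}" ?T] by force
  obtain a \<beta> where ab: "w = (a, \<beta>)" by (cases w)
  have sep: "a \<bullet> q + \<beta> * f q \<le> a \<bullet> y + \<beta> * r" if "f y < r" for y r
    using w(2) w(3)[of "(y, r)"] that by (simp add: ab)
  \<comment> \<open>A vertical hyperplane is impossible because \<open>f\<close> is finite on both sides of \<open>q\<close>.\<close>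
  have "\<beta> > 0"
  proof (rule ccontr)
    assume "\<not> \<beta> > 0"
    moreover have "\<beta> \<ge> 0" using sep[of q "f q + 1"] by (simp add: algebra_simps)
    ultimately have "\<beta> = 0" by simp
    then have "a \<bullet> a \<le> 0"
      using sep[of "q - a" "f (q - a) + 1"] by (simp add: inner_diff_right)
    then have "a = 0" by (metis inner_gt_zero_iff not_le)
    then show False using w(1) ab \<open>\<beta> = 0\<close> by (simp add: zero_prod_def)
  qed
  have "f q + (- (1 / \<beta>) *\<^sub>R a) \<bullet> (y - q) \<le> f y" for y
  proof (rule le_of_le_add_small_multiple[of _ _ 1])
    fix t :: real assume "0 < t" "t < 1"
    have "a \<bullet> q + \<beta> * f q \<le> a \<bullet> y + \<beta> * (f y + t)"
      using sep[of y "f y + t"] \<open>0 < t\<close> by simp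
    then show "f q + (- (1 / \<beta>) *\<^sub>R a) \<bullet> (y - q) \<le> f y + t * 1"
      using \<open>\<beta> > 0\<close> by (simp add: field_simps inner_diff_right)
  qed
  then show thesis by (intro that[of "- (1 / \<beta>) *\<^sub>R a"]) (simp add: subdifferential_def)
qed

text \<open>Strong convexity of the conjugate is smoothness of the function: this is the quadratic upper bound
that a gradient with Lipschitz constant \<open>1 / \<sigma>\<close> gives, stated without derivatives. With
\<open>t\<close> a subgradient at \<open>x\<close>, one has \<open>f x = t \<bullet> x - f\<^sup>* t\<close>, and the strong convexity inequality of
\<open>f\<^sup>*\<close> between \<open>s\<close> and \<open>t\<close> bounds \<open>f\<^sup>* t\<close> from below.\<close>
lemma strongly_convex_conj_descent:
  fixes f :: "'a::euclidean_space \<Rightarrow> real"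
  assumes conv: "convex_on UNIV f" and "\<sigma> > 0"
    and sc: "strongly_convex \<sigma> (fenchel_conj (\<lambda>x. ereal (f x)))"
    and s: "s \<in> subdifferential f q"
  shows "f x \<le> f q + s \<bullet> (x - q) + (norm (x - q))\<^sup>2 / (2 * \<sigma>)"
proof -
  let ?F = "fenchel_conj (\<lambda>x. ereal (f x))"
  obtain t where t: "t \<in> subdifferential f x"
    using convex_real_has_subgradient[OF conv] .
  have F: "?F s = ereal (s \<bullet> q - f q)" "?F t = ereal (t \<bullet> x - f x)"
    using fenchel_conj_subgradient s t by blast+
  \<comment> \<open>\<open>q\<close> is a subgradient of the conjugate at \<open>s\<close>; strong convexity adds the quadratic term.\<close>
  have "q \<bullet> (t - s) + \<sigma> / 2 * (norm (s - t))\<^sup>2 \<le> (t \<bullet> x - f x) - (s \<bullet> q - f q)"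
  proof (rule le_of_le_add_small_multiple[of _ _ "\<sigma> / 2 * (norm (s - t))\<^sup>2"])
    fix r :: real assume r: "0 < r" "r < 1"
    let ?y = "(1 - r) *\<^sub>R s + r *\<^sub>R t"
    let ?N = "(norm (s - t))\<^sup>2"
    have "ereal (?y \<bullet> q - f q + \<sigma> / 2 * r * (1 - r) * ?N)
        \<le> ?F ?y + ereal (\<sigma> / 2 * r * (1 - r) * ?N)"
      using add_right_mono[OF fenchel_young_real[of ?y q f], of "ereal (\<sigma> / 2 * r * (1 - r) * ?N)"]
      by simp
    also have "\<dots> \<le> ereal (1 - r) * ?F s + ereal r * ?F t"
      using sc r unfolding strongly_convex_def by simp
    finally have "?y \<bullet> q - f q + \<sigma> / 2 * r * (1 - r) * ?N
        \<le> (1 - r) * (s \<bullet> q - f q) + r * (t \<bullet> x - f x)"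
      by (simp add: F)
    moreover have "?y \<bullet> q = s \<bullet> q + r * (q \<bullet> (t - s))"
      by (simp add: inner_add_left inner_diff_right inner_commute algebra_simps)
    ultimately have "r * (q \<bullet> (t - s) + \<sigma> / 2 * (1 - r) * ?N)
        \<le> r * ((t \<bullet> x - f x) - (s \<bullet> q - f q))"
      by (simp add: algebra_simps)
    then have "q \<bullet> (t - s) + \<sigma> / 2 * (1 - r) * ?N \<le> (t \<bullet> x - f x) - (s \<bullet> q - f q)"
      using r by simp
    then show "q \<bullet> (t - s) + \<sigma> / 2 * ?N \<le> (t \<bullet> x - f x) - (s \<bullet> q - f q) + r * (\<sigma> / 2 * ?N)"
      by (simp add: algebra_simps diff_divide_distrib)
  qed
  moreover have "(t - s) \<bullet> (x - q) \<le> \<sigma> / 2 * (norm (s - t))\<^sup>2 + (norm (x - q))\<^sup>2 / (2 * \<sigma>)"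
  proof -
    have "0 \<le> (norm (\<sigma> *\<^sub>R (t - s) - (x - q)))\<^sup>2" by simp
    also have "\<dots> = \<sigma>\<^sup>2 * (norm (s - t))\<^sup>2 - 2 * \<sigma> * ((t - s) \<bullet> (x - q)) + (norm (x - q))\<^sup>2"
      by (simp only: power2_norm_eq_inner)
        (simp add: inner_diff_left inner_diff_right inner_commute power2_eq_square algebra_simps)
    finally have "2 * \<sigma> * ((t - s) \<bullet> (x - q))
        \<le> 2 * \<sigma> * (\<sigma> / 2 * (norm (s - t))\<^sup>2 + (norm (x - q))\<^sup>2 / (2 * \<sigma>))"
      using \<open>\<sigma> > 0\<close> by (simp add: algebra_simps power2_eq_square)
    then show ?thesis using \<open>\<sigma> > 0\<close> by (simp add: mult_le_cancel_left)
  qed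
  ultimately show ?thesis
    by (simp add: inner_diff_left inner_diff_right inner_commute algebra_simps)
qed

section \<open>One subgradient update\<close>

lemma prox_subgradient:
  fixes h :: "'a::real_inner \<Rightarrow> real"
  assumes "convex_on UNIV h" and min: "p minimizes (\<lambda>x. 1/2 * (norm (c - x))\<^sup>2 + h x)"
  shows "c - p \<in> subdifferential h p"
  unfolding subdifferential_def
proof (clarify)
  fix x
  show "h p + (c - p) \<bullet> (x - p) \<le> h x"
  proof (rule le_of_le_add_small_multiple[of _ _ "1/2 * (norm (x - p))\<^sup>2"])
    fix t :: real assume t: "0 < t" "t < 1"
    let ?y = "(1 - t) *\<^sub>R p + t *\<^sub>R x"
    have "1/2 * (norm (c - p))\<^sup>2 + h p \<le> 1/2 * (norm (c - ?y))\<^sup>2 + h ?y"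
      using min by (simp add: minimizes_iff)
    moreover have "h ?y \<le> (1 - t) * h p + t * h x"
      using assms(1) t by (auto simp: convex_on_def)
    moreover have "c - ?y = (c - p) - t *\<^sub>R (x - p)" by (simp add: algebra_simps)
    then have "(norm (c - ?y))\<^sup>2 = (norm (c - p))\<^sup>2 - 2 * t * ((c - p) \<bullet> (x - p))
        + t\<^sup>2 * (norm (x - p))\<^sup>2"
      by (simp only: power2_norm_eq_inner)
        (simp add: inner_diff_left inner_diff_right inner_commute power2_eq_square algebra_simps)
    ultimately have "t * (h p + (c - p) \<bullet> (x - p)) \<le> t * (h x + t * (1/2 * (norm (x - p))\<^sup>2))"
      by (simp add: algebra_simps power2_eq_square)
    then show "h p + (c - p) \<bullet> (x - p) \<le> h x + t * (1/2 * (norm (x - p))\<^sup>2)"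
      using t by simp
  qed
qed

definition convex_minorant :: "('a::real_vector \<Rightarrow> real) \<Rightarrow> ('a \<Rightarrow> real) \<Rightarrow> bool" where
  "convex_minorant \<phi> f \<longleftrightarrow> convex_on UNIV \<phi> \<and> (\<forall>x. \<phi> x \<le> f x)"

text \<open>A minorant whose value at \<open>q\<close> is close to \<open>f q\<close> must have a slope close to that of \<open>f\<close>: otherwise it
would overtake the quadratic upper bound of \<open>f\<close>. The vertical distance at \<open>q\<close> therefore controls the
square of the slope error.\<close>
lemma affine_minorant_slope_bound:
  fixes f :: "'a::real_inner \<Rightarrow> real"
  assumes descent: "\<And>x. f x \<le> f q + s \<bullet> (x - q) + (norm (x - q))\<^sup>2 / (2 * \<sigma>)"
    and "\<sigma> > 0" and minor: "\<And>x. \<zeta> \<bullet> x - b \<le> f x"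
  shows "\<sigma> / 2 * (norm (s - \<zeta>))\<^sup>2 \<le> f q - (\<zeta> \<bullet> q - b)"
proof -
  \<comment> \<open>The point where the quadratic upper bound comes closest to the affine function.\<close>
  let ?x = "q - \<sigma> *\<^sub>R (s - \<zeta>)"
  have "\<zeta> \<bullet> ?x - b \<le> f q + s \<bullet> (?x - q) + (norm (?x - q))\<^sup>2 / (2 * \<sigma>)"
    using minor[of ?x] descent[of ?x] by linarith
  moreover have "(norm (?x - q))\<^sup>2 / (2 * \<sigma>) = \<sigma> / 2 * (norm (s - \<zeta>))\<^sup>2"
    using \<open>\<sigma> > 0\<close> by (simp add: power_mult_distrib power2_eq_square)
  moreover have "\<sigma> * (norm (s - \<zeta>))\<^sup>2 = \<sigma> * (s \<bullet> (s - \<zeta>)) - \<sigma> * (\<zeta> \<bullet> (s - \<zeta>))"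
    by (simp add: power2_norm_eq_inner inner_diff_left inner_diff_right algebra_simps)
  ultimately show ?thesis by (simp add: inner_diff_right)
qed

text \<open>The vertical distance between \<open>f\<close> and an affine minorant at \<open>q\<close> controls the distance at nearby
points, because the slope error is controlled too. It is used with \<open>q\<close> a component of the current
residual and \<open>x\<close> the same component of a nearby feasible point.\<close>
lemma affine_minorant_gap_bound:
  fixes f :: "'a::real_inner \<Rightarrow> real"
  assumes descent: "\<And>x. f x \<le> f q + s \<bullet> (x - q) + (norm (x - q))\<^sup>2 / (2 * \<sigma>)"
    and "\<sigma> > 0" and minor: "\<And>x. \<zeta> \<bullet> x - b \<le> f x"
  shows "f x - (\<zeta> \<bullet> x - b)
    \<le> (1 + 1 / \<sigma>) * (f q - (\<zeta> \<bullet> q - b)) + (1/2 + 1 / (2 * \<sigma>)) * (norm (x - q))\<^sup>2"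
proof -
  define \<delta> where "\<delta> = f q - (\<zeta> \<bullet> q - b)"
  have "(norm (s - \<zeta>))\<^sup>2 / 2 \<le> \<delta> / \<sigma>"
    using affine_minorant_slope_bound[OF assms] \<open>\<sigma> > 0\<close> by (simp add: field_simps \<delta>_def)
  moreover have "(s - \<zeta>) \<bullet> (x - q) \<le> (norm (s - \<zeta>))\<^sup>2 / 2 + (norm (x - q))\<^sup>2 / 2"
  proof -
    have "0 \<le> (norm ((s - \<zeta>) - (x - q)))\<^sup>2" by simp
    also have "\<dots> = (norm (s - \<zeta>))\<^sup>2 + (norm (x - q))\<^sup>2 - 2 * ((s - \<zeta>) \<bullet> (x - q))"
      by (simp add: dot_norm_neg field_simps)
    finally show ?thesis by simp
  qed
  moreover have "f x \<le> f q + s \<bullet> (x - q) + (norm (x - q))\<^sup>2 / (2 * \<sigma>)" by (rule descent)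
  then have "f x - (\<zeta> \<bullet> x - b) \<le> \<delta> + (s - \<zeta>) \<bullet> (x - q) + (norm (x - q))\<^sup>2 / (2 * \<sigma>)"
    by (simp add: \<delta>_def inner_diff_left inner_diff_right)
  moreover have "(1 + 1 / \<sigma>) * \<delta> = \<delta> + \<delta> / \<sigma>"
    by (simp add: algebra_simps)
  moreover have "(1/2 + 1 / (2 * \<sigma>)) * (norm (x - q))\<^sup>2
      = (norm (x - q))\<^sup>2 / 2 + (norm (x - q))\<^sup>2 / (2 * \<sigma>)"
    by (simp add: algebra_simps)
  ultimately show ?thesis
    unfolding \<delta>_def[symmetric] by linarith
qed

text \<open>The new function is the tangent of the cut function \<open>h\<close> at its proximal point, so it stays below
\<open>h\<close> and hence below \<open>f\<close>; its slope is the new dual variable, which makes the conjugate finite there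
whatever the old value was.\<close>
lemma subgradient_update_minorant:
  assumes upd: "subgradient_update f c \<phi> \<zeta> \<phi>' \<zeta>'" and \<phi>: "convex_minorant \<phi> f"
  shows "convex_minorant \<phi>' f"
    and "\<exists>b'. fenchel_conj (\<lambda>x. ereal (\<phi>' x)) \<zeta>' = ereal b'"
proof -
  define q where "q = c - \<zeta>"
  obtain s p where s: "s \<in> subdifferential f q"
    and p: "p minimizes (\<lambda>x. 1/2 * (norm (c - x))\<^sup>2 + max (\<phi> x) (f q + s \<bullet> (x - q)))"
    and \<zeta>': "\<zeta>' = c - p"
    and \<phi>': "\<phi>' = (\<lambda>x. max (\<phi> p) (f q + s \<bullet> (p - q)) + (x - p) \<bullet> \<zeta>')"
    using upd unfolding subgradient_update_def Let_def q_def by blast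
  let ?h = "\<lambda>x. max (\<phi> x) (f q + s \<bullet> (x - q))"
  have affine: "convex_on UNIV (\<lambda>x. a + v \<bullet> (x - r))" for a v and r :: 'a
  proof (rule convex_onI)
    fix t :: real and x y :: 'a
    have "v \<bullet> ((1 - t) *\<^sub>R x + t *\<^sub>R y - r) = (1 - t) * (v \<bullet> (x - r)) + t * (v \<bullet> (y - r))"
      by (simp add: inner_add_right inner_diff_right algebra_simps)
    then show "a + v \<bullet> ((1 - t) *\<^sub>R x + t *\<^sub>R y - r)
        \<le> (1 - t) * (a + v \<bullet> (x - r)) + t * (a + v \<bullet> (y - r))"
      by (simp add: algebra_simps)
  qed simp
  have "convex_on UNIV ?h"
  proof (rule convex_onI)
    fix t :: real and x y :: 'a assume t: "0 < t" "t < 1"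
    let ?z = "(1 - t) *\<^sub>R x + t *\<^sub>R y" and ?l = "\<lambda>x. f q + s \<bullet> (x - q)"
    have "\<phi> ?z \<le> (1 - t) * \<phi> x + t * \<phi> y"
      using \<phi> t by (auto simp: convex_minorant_def convex_on_def)
    also have "\<dots> \<le> (1 - t) * ?h x + t * ?h y"
      using t by (intro add_mono mult_left_mono) auto
    finally have 1: "\<phi> ?z \<le> (1 - t) * ?h x + t * ?h y" .
    have "?l ?z \<le> (1 - t) * ?l x + t * ?l y"
      using affine[of "f q" s q] t unfolding convex_on_def by auto
    also have "\<dots> \<le> (1 - t) * ?h x + t * ?h y"
      using t by (intro add_mono mult_left_mono) auto
    finally show "?h ?z \<le> (1 - t) * ?h x + t * ?h y" using 1 by simp
  qed simp
  then have sub: "?h p + \<zeta>' \<bullet> (x - p) \<le> ?h x" for x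
    using prox_subgradient[OF _ p] by (simp add: subdifferential_def \<zeta>')
  have below: "?h x \<le> f x" for x
    using s \<phi> by (simp add: subdifferential_def convex_minorant_def)
  then have "\<phi>' x \<le> f x" for x
    using sub[of x] below[of x] unfolding \<phi>' by (metis inner_commute order_trans)
  moreover have "convex_on UNIV \<phi>'"
    using affine[of "?h p" \<zeta>' p] unfolding \<phi>' by (simp add: inner_commute)
  ultimately show "convex_minorant \<phi>' f" by (simp add: convex_minorant_def)
  have "\<zeta>' \<in> subdifferential \<phi>' p"
    by (simp add: subdifferential_def \<phi>' inner_commute)
  from fenchel_conj_subgradient[OF this]
  show "\<exists>b'. fenchel_conj (\<lambda>x. ereal (\<phi>' x)) \<zeta>' = ereal b'" by blast
qed

text \<open>Finiteness of the conjugate at \<open>\<zeta>\<close> means that \<open>\<zeta> \<bullet> x - b\<close> is an affine minorant of \<open>\<phi>\<close>, and for this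
affine function the proximal point of \<open>c\<close> is \<open>q = c - \<zeta>\<close>. Comparing with it instead of \<open>\<phi>\<close> gives an
exact formula for the decrease of the dual value. The surplus \<open>e\<close> is the height of the cut function
above the affine minorant at the new proximal point; the last inequality is the contribution of the
new cut.\<close>
lemma subgradient_update_decrease:
  assumes upd: "subgradient_update f c \<phi> \<zeta> \<phi>' \<zeta>'"
    and b: "fenchel_conj (\<lambda>x. ereal (\<phi> x)) \<zeta> = ereal b"
    and b': "fenchel_conj (\<lambda>x. ereal (\<phi>' x)) \<zeta>' = ereal b'"
  defines "q \<equiv> c - \<zeta>"
  obtains s e where "s \<in> subdifferential f q"
    and "1/2 * (norm (c - \<zeta>'))\<^sup>2 + b' = 1/2 * (norm q)\<^sup>2 + b - 1/2 * (norm (\<zeta>' - \<zeta>))\<^sup>2 - e"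
    and "0 \<le> e" and "f q - (\<zeta> \<bullet> q - b) - (s - \<zeta>) \<bullet> (\<zeta>' - \<zeta>) \<le> e"
proof -
  obtain s p where s: "s \<in> subdifferential f q"
    and \<zeta>': "\<zeta>' = c - p"
    and \<phi>': "\<phi>' = (\<lambda>x. max (\<phi> p) (f q + s \<bullet> (p - q)) + (x - p) \<bullet> \<zeta>')"
    using upd unfolding subgradient_update_def Let_def q_def by blast
  let ?hp = "max (\<phi> p) (f q + s \<bullet> (p - q))"
  have "\<zeta>' \<in> subdifferential \<phi>' p"
    by (simp add: subdifferential_def \<phi>' inner_commute)
  from fenchel_conj_subgradient[OF this] b' have b'_eq: "b' = \<zeta>' \<bullet> p - ?hp"
    by (simp add: \<phi>')
  define e where "e = ?hp - (\<zeta> \<bullet> p - b)"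
  have "\<zeta> \<bullet> p - \<phi> p \<le> b"
    using b fenchel_conj_le_iff[of \<phi> \<zeta> b] by simp
  then have 1: "0 \<le> e" unfolding e_def by linarith
  have cz: "c = q + \<zeta>" "\<zeta>' - \<zeta> = q - p" by (simp_all add: q_def \<zeta>')
  have "f q - (\<zeta> \<bullet> q - b) - (s - \<zeta>) \<bullet> (q - p) = f q + s \<bullet> (p - q) - (\<zeta> \<bullet> p - b)"
    by (simp add: inner_diff_left inner_diff_right)
  then have 2: "f q - (\<zeta> \<bullet> q - b) - (s - \<zeta>) \<bullet> (\<zeta>' - \<zeta>) \<le> e"
    unfolding cz e_def by simp
  have p: "p = q + \<zeta> - \<zeta>'" by (simp add: q_def \<zeta>')
  have "1/2 * (norm p)\<^sup>2 + (\<zeta>' \<bullet> p - ?hp)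
      = 1/2 * (norm q)\<^sup>2 + b - 1/2 * (norm (\<zeta>' - \<zeta>))\<^sup>2 - (?hp - (\<zeta> \<bullet> p - b))"
    unfolding power2_norm_eq_inner p
    by (simp add: inner_diff_left inner_diff_right inner_add_left inner_add_right inner_commute
        algebra_simps)
  then have 3: "1/2 * (norm (c - \<zeta>'))\<^sup>2 + b'
      = 1/2 * (norm q)\<^sup>2 + b - 1/2 * (norm (\<zeta>' - \<zeta>))\<^sup>2 - e"
    by (simp add: \<zeta>' b'_eq e_def)
  show thesis by (rule that[OF s 3 1 2])
qed

text \<open>The decrease is proportional to the vertical distance \<open>\<delta>\<close> between \<open>f\<close> and its affine minorant at \<open>q\<close>.
A short move \<open>u\<close> keeps the cut active, which costs about \<open>\<delta>\<close>, and a long move costs \<open>norm u ^ 2 / 2\<close>;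
since the slope error is at most of order \<open>sqrt \<delta>\<close>, a move that deactivates the cut has a length of
order at least \<open>sqrt \<delta>\<close>.\<close>
lemma subgradient_update_decrease_gap:
  fixes f :: "'a::euclidean_space \<Rightarrow> real"
  assumes upd: "subgradient_update f c \<phi> \<zeta> \<phi>' \<zeta>'" and \<phi>: "convex_minorant \<phi> f"
    and b: "fenchel_conj (\<lambda>x. ereal (\<phi> x)) \<zeta> = ereal b"
    and b': "fenchel_conj (\<lambda>x. ereal (\<phi>' x)) \<zeta>' = ereal b'"
    and f: "convex_on UNIV f" "\<sigma> > 0" "strongly_convex \<sigma> (fenchel_conj (\<lambda>x. ereal (f x)))"
  defines "q \<equiv> c - \<zeta>"
  shows "1/2 * (norm (c - \<zeta>'))\<^sup>2 + b'
    \<le> 1/2 * (norm q)\<^sup>2 + b - min 1 (\<sigma> / 2) / 2 * (f q - (\<zeta> \<bullet> q - b))"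
proof -
  define \<delta> where "\<delta> = f q - (\<zeta> \<bullet> q - b)"
  obtain s e where s: "s \<in> subdifferential f q"
    and eq: "1/2 * (norm (c - \<zeta>'))\<^sup>2 + b'
      = 1/2 * (norm q)\<^sup>2 + b - 1/2 * (norm (\<zeta>' - \<zeta>))\<^sup>2 - e"
    and e: "0 \<le> e" "\<delta> - (s - \<zeta>) \<bullet> (\<zeta>' - \<zeta>) \<le> e"
    using subgradient_update_decrease[OF upd b b'] unfolding q_def \<delta>_def by blast
  have minor: "\<zeta> \<bullet> x - b \<le> f x" for x
  proof -
    have "\<zeta> \<bullet> x - \<phi> x \<le> b" using b fenchel_conj_le_iff[of \<phi> \<zeta> b] by simp
    moreover have "\<phi> x \<le> f x" using \<phi> by (simp add: convex_minorant_def)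
    ultimately show ?thesis by linarith
  qed
  have slope: "\<sigma> / 2 * (norm (s - \<zeta>))\<^sup>2 \<le> \<delta>"
    unfolding \<delta>_def
    using affine_minorant_slope_bound[OF strongly_convex_conj_descent[OF f s] f(2) minor] .
  \<comment> \<open>The surplus \<open>e\<close> is at least \<open>l * e\<close>, and completing the square in \<open>norm u ^ 2 / 2 + l * e\<close> costs
      \<open>l ^ 2 * norm a ^ 2 / 2 \<le> l ^ 2 * \<delta> / \<sigma>\<close>, at most half of the gain \<open>l * \<delta>\<close> when \<open>l \<le> \<sigma> / 2\<close>.\<close>
  define l where "l = min 1 (\<sigma> / 2)"
  have l: "0 < l" "l \<le> 1" "l \<le> \<sigma> / 2" using f(2) by (auto simp: l_def)
  let ?u = "\<zeta>' - \<zeta>" and ?a = "s - \<zeta>"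
  have "0 \<le> (norm (?u - l *\<^sub>R ?a))\<^sup>2" by simp
  also have "\<dots> = (norm ?u)\<^sup>2 - 2 * l * (?a \<bullet> ?u) + l * (l * (norm ?a)\<^sup>2)"
    by (simp only: power2_norm_eq_inner)
      (simp add: inner_diff_left inner_diff_right inner_commute algebra_simps)
  also have "l * (l * (norm ?a)\<^sup>2) \<le> l * \<delta>"
  proof (rule mult_left_mono)
    have "l * (norm ?a)\<^sup>2 \<le> \<sigma> / 2 * (norm ?a)\<^sup>2" using l by (intro mult_right_mono) auto
    then show "l * (norm ?a)\<^sup>2 \<le> \<delta>" using slope by linarith
  qed (use l in simp)
  finally have "l * (?a \<bullet> ?u) \<le> 1/2 * (norm ?u)\<^sup>2 + l * \<delta> / 2" by simp
  moreover have "l * (\<delta> - ?a \<bullet> ?u) \<le> l * e" using e l by (intro mult_left_mono) auto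
  then have "l * \<delta> - l * (?a \<bullet> ?u) \<le> l * e" by (simp add: algebra_simps)
  moreover have "l * e \<le> e" using e l by (simp add: mult_left_le_one_le)
  ultimately have "l / 2 * \<delta> \<le> 1/2 * (norm ?u)\<^sup>2 + e" by (simp add: algebra_simps)
  then show ?thesis unfolding eq \<delta>_def[symmetric] l_def[symmetric] by linarith
qed

section \<open>The dual objective\<close>

definition residual ::
  "'v::finite set set \<Rightarrow> real ^ 'm::finite ^ 'v \<Rightarrow> (('v, 'm) idx \<Rightarrow> real ^ 'm ^ 'v) \<Rightarrow> real ^ 'm ^ 'v" where
  "residual E xbar z = xbar - (\<Sum>\<alpha>\<in>indices E. z \<alpha>)"

text \<open>Finiteness of the dual objective made explicit: \<open>b i\<close> is the value of the \<open>i\<close>-th conjugate, so that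
\<open>z (Inl i) $ i \<bullet> x - b i\<close> is an affine minorant of \<open>g i\<close>.\<close>
definition dual_point ::
  "'v::finite set set \<Rightarrow> ('v \<Rightarrow> real ^ 'm::finite \<Rightarrow> real) \<Rightarrow> (('v, 'm) idx \<Rightarrow> real ^ 'm ^ 'v)
    \<Rightarrow> ('v \<Rightarrow> real) \<Rightarrow> bool" where
  "dual_point E g z b \<longleftrightarrow>
     (\<forall>i. (\<forall>j. j \<noteq> i \<longrightarrow> z (Inl i) $ j = 0) \<and>
          fenchel_conj (\<lambda>x. ereal (g i x)) (z (Inl i) $ i) = ereal (b i)) \<and>
     (\<forall>\<alpha>\<in>Ebar E. z (Inr \<alpha>) \<in> (H \<alpha>)\<^sup>\<bottom>)"

definition dual_value ::
  "'v::finite set set \<Rightarrow> real ^ 'm::finite ^ 'v \<Rightarrow> (('v, 'm) idx \<Rightarrow> real ^ 'm ^ 'v) \<Rightarrow> ('v \<Rightarrow> real) \<Rightarrow> real" where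
  "dual_value E xbar z b = (\<Sum>i\<in>UNIV. b i) + 1/2 * (norm (residual E xbar z))\<^sup>2"

lemma mem_orthogonal_comp: "v \<in> U\<^sup>\<bottom> \<longleftrightarrow> (\<forall>x\<in>U. v \<bullet> x = 0)"
  by (auto simp: orthogonal_comp_def orthogonal_def inner_commute)

lemma subspace_H: "subspace (H \<alpha>)"
proof -
  have "H \<alpha> = (\<Inter>i\<in>fst \<alpha>. \<Inter>j\<in>fst \<alpha>. {x. x $ i $ snd \<alpha> = x $ j $ snd \<alpha>})"
    unfolding H_def by blast
  moreover have "subspace {x :: real ^ 'a ^ 'b. x $ i $ k = x $ j $ k}" for i j k
    by (rule subspaceI) simp_all
  then have "subspace (\<Inter>j\<in>fst \<alpha>. {x :: real ^ 'a ^ 'b. x $ i $ snd \<alpha> = x $ j $ snd \<alpha>})" for i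
    by (intro subspace_Inter) blast
  ultimately show ?thesis
    by (simp only:) (intro subspace_Inter; blast)
qed

lemma subspace_D: "subspace (D E)"
  unfolding D_def by (rule subspace_Inter) (use subspace_H in blast)

lemma sum_indices:
  "(\<Sum>\<alpha>\<in>indices E. h \<alpha>) = (\<Sum>i\<in>UNIV. h (Inl i)) + (\<Sum>\<alpha>\<in>Ebar E. h (Inr \<alpha>))"
  for E :: "'v::finite set set" and h :: "('v, 'm::finite) idx \<Rightarrow> 'c::comm_monoid_add"
  unfolding indices_def
  by (subst sum.union_disjoint) (auto simp: sum.reindex)

lemma fenchel_conj_indicator:
  assumes "subspace U"
  shows "fenchel_conj (indicator_fun U) v = (if v \<in> U\<^sup>\<bottom> then 0 else \<infinity>)"
proof (cases "v \<in> U\<^sup>\<bottom>")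
  case True
  have "fenchel_conj (indicator_fun U) v \<le> 0"
    unfolding fenchel_conj_def using True
    by (intro SUP_least) (auto simp: indicator_fun_def mem_orthogonal_comp)
  moreover have "0 \<le> fenchel_conj (indicator_fun U) v"
    using fenchel_young[of v 0 "indicator_fun U"] subspace_0[OF assms]
    by (simp add: indicator_fun_def zero_ereal_def)
  ultimately show ?thesis using True by simp
next
  case False
  then obtain x where x: "x \<in> U" "v \<bullet> x \<noteq> 0" by (auto simp: mem_orthogonal_comp)
  have "ereal r \<le> fenchel_conj (indicator_fun U) v" for r
    using fenchel_young[of v "(r / (v \<bullet> x)) *\<^sub>R x" "indicator_fun U"] x
      subspace_scale[OF assms x(1)]
    by (simp add: indicator_fun_def)
  then have "fenchel_conj (indicator_fun U) v = \<infinity>"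
    by (rule ereal_top)
  then show ?thesis using False by simp
qed

lemma inner_supported_at:
  assumes "\<And>j. j \<noteq> i \<Longrightarrow> v $ j = 0"
  shows "v \<bullet> x = v $ i \<bullet> x $ i"
proof -
  have "v \<bullet> x = (\<Sum>j\<in>UNIV. if j = i then v $ i \<bullet> x $ i else 0)"
    unfolding inner_vec_def using assms by (intro sum.cong) auto
  then show ?thesis by simp
qed

text \<open>A function that depends on the \<open>i\<close>-th component only has a conjugate that is infinite unless all
other components of its argument vanish: moving along any other component is free.\<close>
lemma fenchel_conj_bold_vertex:
  "fenchel_conj (bold g (Inl i)) v
    = (if \<forall>j. j \<noteq> i \<longrightarrow> v $ j = 0 then fenchel_conj (\<lambda>x. ereal (g i x)) (v $ i) else \<infinity>)"
proof (cases "\<forall>j. j \<noteq> i \<longrightarrow> v $ j = 0")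
  case True
  then have v: "v \<bullet> x = v $ i \<bullet> x $ i" for x by (intro inner_supported_at) simp
  have "fenchel_conj (bold g (Inl i)) v = fenchel_conj (\<lambda>x. ereal (g i x)) (v $ i)"
  proof (rule antisym)
    show "fenchel_conj (bold g (Inl i)) v \<le> fenchel_conj (\<lambda>x. ereal (g i x)) (v $ i)"
      unfolding fenchel_conj_def[of "bold g (Inl i)"]
      using fenchel_young_real by (intro SUP_least) (simp add: v)
    show "fenchel_conj (\<lambda>x. ereal (g i x)) (v $ i) \<le> fenchel_conj (bold g (Inl i)) v"
      unfolding fenchel_conj_def[of "\<lambda>x. ereal (g i x)"]
    proof (rule SUP_least)
      fix y
      show "ereal (v $ i \<bullet> y) - ereal (g i y) \<le> fenchel_conj (bold g (Inl i)) v"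
        using fenchel_young[of v "\<chi> j. y" "bold g (Inl i)"] by (simp add: v)
    qed
  qed
  then show ?thesis using True by simp
next
  case False
  then obtain j where j: "j \<noteq> i" "v $ j \<noteq> 0" by blast
  have "ereal r \<le> fenchel_conj (bold g (Inl i)) v" for r
  proof -
    define x where "x = axis j (((r + g i 0) / (v $ j \<bullet> v $ j)) *\<^sub>R v $ j)"
    have "v \<bullet> x = r + g i 0" "x $ i = 0"
      using j by (simp_all add: x_def inner_axis) (simp add: axis_def)
    then show ?thesis
      using fenchel_young[of v x "bold g (Inl i)"] by simp
  qed
  then have "fenchel_conj (bold g (Inl i)) v = \<infinity>"
    by (rule ereal_top)
  then show ?thesis using False by auto
qed

lemma fenchel_conj_bold_not_MInfty: "fenchel_conj (bold g \<alpha>) v \<noteq> - \<infinity>"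
proof (cases \<alpha>)
  case (Inl i)
  have "fenchel_conj (\<lambda>x. ereal (g i x)) (v $ i) \<noteq> - \<infinity>"
    using fenchel_young_real[of "v $ i" 0 "g i"] by auto
  then show ?thesis by (simp add: Inl fenchel_conj_bold_vertex del: bold.simps)
next
  case (Inr \<beta>)
  then show ?thesis by (simp add: fenchel_conj_indicator subspace_H)
qed

lemma dual_obj_eq_sum:
  "dual_obj E xbar g z
    = (\<Sum>\<alpha>\<in>indices E. fenchel_conj (bold g \<alpha>) (z \<alpha>)) + ereal (1/2 * (norm (residual E xbar z))\<^sup>2)"
  unfolding dual_obj_def residual_def sum_indices by simp

lemma dual_obj_dual_point:
  assumes "dual_point E g z b"
  shows "dual_obj E xbar g z = ereal (dual_value E xbar z b)"
proof -
  have "(\<Sum>i\<in>UNIV. fenchel_conj (bold g (Inl i)) (z (Inl i))) = (\<Sum>i\<in>UNIV. ereal (b i))"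
    using assms
    by (intro sum.cong) (simp_all add: dual_point_def fenchel_conj_bold_vertex del: bold.simps)
  moreover have "(\<Sum>\<alpha>\<in>Ebar E. fenchel_conj (indicator_fun (H \<alpha>)) (z (Inr \<alpha>))) = 0"
    using assms by (intro sum.neutral) (simp add: dual_point_def fenchel_conj_indicator subspace_H)
  ultimately show ?thesis
    unfolding dual_obj_def dual_value_def residual_def by simp
qed

lemma dual_point_of_finite:
  assumes "dual_obj E xbar g z \<noteq> \<infinity>"
  obtains b where "dual_point E g z b"
proof -
  have fin: "fenchel_conj (bold g \<alpha>) (z \<alpha>) \<noteq> \<infinity>" if "\<alpha> \<in> indices E" for \<alpha>
  proof
    assume "fenchel_conj (bold g \<alpha>) (z \<alpha>) = \<infinity>"
    then have "(\<Sum>\<alpha>\<in>indices E. fenchel_conj (bold g \<alpha>) (z \<alpha>)) = \<infinity>"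
      using that by (auto simp: sum_Pinfty)
    then show False using assms by (simp add: dual_obj_eq_sum)
  qed
  have "z (Inr \<alpha>) \<in> (H \<alpha>)\<^sup>\<bottom>" if "\<alpha> \<in> Ebar E" for \<alpha>
    using fin[of "Inr \<alpha>"] that
    by (auto simp: indices_def fenchel_conj_indicator subspace_H split: if_splits)
  moreover have "(\<forall>j. j \<noteq> i \<longrightarrow> z (Inl i) $ j = 0) \<and>
      (\<exists>b. fenchel_conj (\<lambda>x. ereal (g i x)) (z (Inl i) $ i) = ereal b)" for i
  proof -
    have "fenchel_conj (bold g (Inl i)) (z (Inl i)) \<noteq> \<infinity>"
      "fenchel_conj (bold g (Inl i)) (z (Inl i)) \<noteq> - \<infinity>"
      using fin[of "Inl i"] fenchel_conj_bold_not_MInfty[of g "Inl i"]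
      by (auto simp: indices_def simp del: bold.simps)
    then show ?thesis
      unfolding fenchel_conj_bold_vertex
      by (cases "fenchel_conj (\<lambda>x. ereal (g i x)) (z (Inl i) $ i)") (auto split: if_splits)
  qed
  then obtain b where "\<And>i. (\<forall>j. j \<noteq> i \<longrightarrow> z (Inl i) $ j = 0) \<and>
      fenchel_conj (\<lambda>x. ereal (g i x)) (z (Inl i) $ i) = ereal (b i)" by metis
  ultimately have "dual_point E g z b" by (simp add: dual_point_def)
  then show thesis by (rule that)
qed

lemma residual_nth:
  assumes "\<And>i j. j \<noteq> i \<Longrightarrow> z (Inl i) $ j = 0"
  shows "residual E xbar z $ i = (xbar - vH E z) $ i - z (Inl i) $ i"
proof -
  have "(\<Sum>k\<in>UNIV. z (Inl k) $ i) = (\<Sum>k\<in>UNIV. if k = i then z (Inl i) $ i else 0)"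
    using assms by (intro sum.cong) auto
  then show ?thesis
    by (simp add: residual_def vH_def sum_indices)
qed

lemma norm_vec_power2: "(norm x)\<^sup>2 = (\<Sum>i\<in>UNIV. (norm (x $ i))\<^sup>2)" for x :: "'a::real_inner ^ 'n"
  by (simp add: power2_norm_eq_inner inner_vec_def)

lemma dual_value_eq_sum:
  "dual_value E xbar z b = (\<Sum>i\<in>UNIV. 1/2 * (norm (residual E xbar z $ i))\<^sup>2 + b i)"
  by (simp add: dual_value_def norm_vec_power2 sum.distrib sum_distrib_left)

text \<open>The conjugates are convex, and the quadratic term makes the dual objective strongly convex as a
function of the residual.\<close>
lemma dual_point_convex_comb:
  assumes y: "dual_point E g y b" and z: "dual_point E g z d" and t: "0 \<le> t" "t \<le> 1"
  shows "dual_obj E xbar g (\<lambda>\<alpha>. (1 - t) *\<^sub>R y \<alpha> + t *\<^sub>R z \<alpha>)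
    \<le> ereal ((1 - t) * dual_value E xbar y b + t * dual_value E xbar z d
        - t * (1 - t) / 2 * (norm (residual E xbar y - residual E xbar z))\<^sup>2)"
proof -
  let ?m = "\<lambda>\<alpha>. (1 - t) *\<^sub>R y \<alpha> + t *\<^sub>R z \<alpha>"
  have "fenchel_conj (bold g (Inl i)) (?m (Inl i)) \<le> ereal ((1 - t) * b i + t * d i)" for i
  proof -
    have "?m (Inl i) $ i \<bullet> x - g i x \<le> (1 - t) * b i + t * d i" for x
    proof -
      have "y (Inl i) $ i \<bullet> x - g i x \<le> b i" "z (Inl i) $ i \<bullet> x - g i x \<le> d i"
        using y z fenchel_conj_le_iff[of "g i"] by (metis dual_point_def order_refl)+
      then have "(1 - t) * (y (Inl i) $ i \<bullet> x - g i x) + t * (z (Inl i) $ i \<bullet> x - g i x)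
          \<le> (1 - t) * b i + t * d i"
        using t by (intro add_mono mult_left_mono) auto
      then show ?thesis by (simp add: inner_add_left algebra_simps)
    qed
    then have "fenchel_conj (\<lambda>x. ereal (g i x)) (?m (Inl i) $ i) \<le> ereal ((1 - t) * b i + t * d i)"
      unfolding fenchel_conj_le_iff by blast
    moreover have "\<forall>j. j \<noteq> i \<longrightarrow> ?m (Inl i) $ j = 0"
      using y z by (simp add: dual_point_def)
    ultimately show ?thesis unfolding fenchel_conj_bold_vertex by simp
  qed
  then have "(\<Sum>i\<in>UNIV. fenchel_conj (bold g (Inl i)) (?m (Inl i)))
      \<le> (\<Sum>i\<in>UNIV. ereal ((1 - t) * b i + t * d i))"
    by (intro sum_mono)
  also have "\<dots> = ereal ((1 - t) * (\<Sum>i\<in>UNIV. b i) + t * (\<Sum>i\<in>UNIV. d i))"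
    by (simp add: sum.distrib sum_distrib_left)
  finally have 1: "(\<Sum>i\<in>UNIV. fenchel_conj (bold g (Inl i)) (?m (Inl i)))
      \<le> ereal ((1 - t) * (\<Sum>i\<in>UNIV. b i) + t * (\<Sum>i\<in>UNIV. d i))" .
  have "?m (Inr \<alpha>) \<in> (H \<alpha>)\<^sup>\<bottom>" if "\<alpha> \<in> Ebar E" for \<alpha>
    using y z that by (simp add: dual_point_def mem_orthogonal_comp inner_add_left)
  then have 2: "(\<Sum>\<alpha>\<in>Ebar E. fenchel_conj (indicator_fun (H \<alpha>)) (?m (Inr \<alpha>))) = 0"
    by (intro sum.neutral) (simp add: fenchel_conj_indicator subspace_H)
  let ?r = "residual E xbar y" and ?s = "residual E xbar z"
  have "(\<Sum>\<alpha>\<in>indices E. ?m \<alpha>)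
      = (1 - t) *\<^sub>R (\<Sum>\<alpha>\<in>indices E. y \<alpha>) + t *\<^sub>R (\<Sum>\<alpha>\<in>indices E. z \<alpha>)"
    by (simp add: sum.distrib scaleR_right.sum)
  then have "xbar - (\<Sum>\<alpha>\<in>indices E. ?m \<alpha>) = (1 - t) *\<^sub>R ?r + t *\<^sub>R ?s"
    by (simp add: residual_def algebra_simps)
  then have 3: "(norm (xbar - (\<Sum>\<alpha>\<in>indices E. ?m \<alpha>)))\<^sup>2
      = (1 - t) * (norm ?r)\<^sup>2 + t * (norm ?s)\<^sup>2 - t * (1 - t) * (norm (?r - ?s))\<^sup>2"
    by (simp only: power2_norm_eq_inner)
      (simp add: inner_diff_left inner_diff_right inner_add_left inner_add_right inner_commute
        algebra_simps)
  have "dual_obj E xbar g ?m \<le> ereal ((1 - t) * (\<Sum>i\<in>UNIV. b i) + t * (\<Sum>i\<in>UNIV. d i)) + 0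
      + ereal (1/2 * (norm (xbar - (\<Sum>\<alpha>\<in>indices E. ?m \<alpha>)))\<^sup>2)"
    unfolding dual_obj_def 2 by (intro add_mono 1 order_refl)
  also have "\<dots> = ereal ((1 - t) * dual_value E xbar y b + t * dual_value E xbar z d
        - t * (1 - t) / 2 * (norm (?r - ?s))\<^sup>2)"
    unfolding 3 dual_value_def
    by (simp add: algebra_simps add_divide_distrib diff_divide_distrib)
  finally show ?thesis .
qed

section \<open>Exact minimization over a block\<close>

text \<open>The block objective and the dual objective differ by terms that do not depend on the block.\<close>
lemma block_minimizer_dual_obj_le:
  fixes E :: "'v::finite set set" and S :: "('v, 'm::finite) idx set"
  assumes min: "z' minimizes block_obj E xbar g S z"
    and off: "\<And>\<alpha>. \<alpha> \<in> indices E - S \<Longrightarrow> z' \<alpha> = z \<alpha>"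
    and off_y: "\<And>\<alpha>. \<alpha> \<in> indices E - S \<Longrightarrow> y \<alpha> = z \<alpha>"
    and S: "S \<subseteq> indices E"
  shows "dual_obj E xbar g z' \<le> dual_obj E xbar g y"
proof -
  have split: "(\<Sum>\<alpha>\<in>indices E. h \<alpha>) = (\<Sum>\<alpha>\<in>indices E - S. h \<alpha>) + (\<Sum>\<alpha>\<in>S. h \<alpha>)"
    for h :: "_ \<Rightarrow> 'c::comm_monoid_add"
    using S by (intro sum.subset_diff) auto
  have dual: "dual_obj E xbar g u
      = (\<Sum>\<alpha>\<in>indices E - S. fenchel_conj (bold g \<alpha>) (z \<alpha>)) + block_obj E xbar g S z u"
    if "\<And>\<alpha>. \<alpha> \<in> indices E - S \<Longrightarrow> u \<alpha> = z \<alpha>" for u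
  proof -
    have "(\<Sum>\<alpha>\<in>indices E - S. fenchel_conj (bold g \<alpha>) (u \<alpha>))
        = (\<Sum>\<alpha>\<in>indices E - S. fenchel_conj (bold g \<alpha>) (z \<alpha>))"
      "(\<Sum>\<alpha>\<in>indices E - S. u \<alpha>) = (\<Sum>\<alpha>\<in>indices E - S. z \<alpha>)"
      using that by (auto intro!: sum.cong)
    then show ?thesis
      unfolding dual_obj_eq_sum block_obj_def residual_def split by (simp add: ac_simps diff_diff_eq)
  qed
  have "block_obj E xbar g S z z' \<le> block_obj E xbar g S z y"
    using min by (simp add: minimizes_iff)
  then show ?thesis
    using dual[of z'] dual[of y] off off_y by (simp add: add_left_mono)
qed

text \<open>Strong convexity with respect to the residual gives the decrease. If an edge constraint \<open>\<alpha>\<close> belongs to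
the block, its dual variable may be shifted along \<open>(H \<alpha>)\<^sup>\<bottom>\<close> at the sole cost of changing the
residual, so at the minimum the residual is orthogonal to \<open>(H \<alpha>)\<^sup>\<bottom>\<close>, that is, it lies in \<open>H \<alpha>\<close>.\<close>
lemma block_minimizer_step:
  fixes E :: "'v::finite set set" and S :: "('v, 'm::finite) idx set"
  assumes min: "z' minimizes block_obj E xbar g S z"
    and off: "\<And>\<alpha>. \<alpha> \<in> indices E - S \<Longrightarrow> z' \<alpha> = z \<alpha>"
    and S: "S \<subseteq> indices E" and z: "dual_point E g z b"
  obtains b' where "dual_point E g z' b'"
    and "dual_value E xbar z' b'
      \<le> dual_value E xbar z b - 1/2 * (norm (residual E xbar z' - residual E xbar z))\<^sup>2"
    and "\<And>\<alpha>. Inr \<alpha> \<in> S \<Longrightarrow> residual E xbar z' \<in> H \<alpha>"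
proof -
  note le = block_minimizer_dual_obj_le[OF min off _ S]
  have "dual_obj E xbar g z' \<noteq> \<infinity>"
    using le[of z] dual_obj_dual_point[OF z, of xbar] by auto
  then obtain b' where z': "dual_point E g z' b'" by (rule dual_point_of_finite)
  let ?r = "residual E xbar z'" and ?s = "residual E xbar z"
  have decrease: "dual_value E xbar z' b' \<le> dual_value E xbar z b - 1/2 * (norm (?r - ?s))\<^sup>2"
  proof (rule le_of_le_add_small_multiple[of _ _ "1/2 * (norm (?r - ?s))\<^sup>2"])
    fix t :: real assume t: "0 < t" "t < 1"
    have "(1 - t) *\<^sub>R z' \<alpha> + t *\<^sub>R z \<alpha> = z \<alpha>" if "\<alpha> \<in> indices E - S" for \<alpha>
      using off[OF that] by (simp add: scaleR_left_diff_distrib)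
    then have "dual_obj E xbar g z' \<le> dual_obj E xbar g (\<lambda>\<alpha>. (1 - t) *\<^sub>R z' \<alpha> + t *\<^sub>R z \<alpha>)"
      by (intro le) blast
    also note dual_point_convex_comb[OF z' z, of t xbar]
    finally have "t * dual_value E xbar z' b'
        \<le> t * (dual_value E xbar z b - 1/2 * (norm (?r - ?s))\<^sup>2 + t * (1/2 * (norm (?r - ?s))\<^sup>2))"
      using t by (simp add: dual_obj_dual_point[OF z'] algebra_simps diff_divide_distrib)
    then show "dual_value E xbar z' b'
        \<le> dual_value E xbar z b - 1/2 * (norm (?r - ?s))\<^sup>2 + t * (1/2 * (norm (?r - ?s))\<^sup>2)"
      using t by simp
  qed
  have "?r \<in> H \<alpha>" if \<alpha>: "Inr \<alpha> \<in> S" for \<alpha>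
  proof -
    have "?r \<bullet> u = 0" if u: "u \<in> (H \<alpha>)\<^sup>\<bottom>" for u
    proof -
      have "2 * (?r \<bullet> u) * t \<le> t * t * (u \<bullet> u)" for t
      proof -
        let ?y = "z'(Inr \<alpha> := z' (Inr \<alpha>) + t *\<^sub>R u)"
        have "dual_point E g ?y b'"
          using z' u subspace_orthogonal_comp[of "H \<alpha>"]
          by (auto simp: dual_point_def subspace_add subspace_scale)
        moreover have "dual_obj E xbar g z' \<le> dual_obj E xbar g ?y"
          by (rule le) (use off \<alpha> in auto)
        ultimately have "dual_value E xbar z' b' \<le> dual_value E xbar ?y b'"
          using dual_obj_dual_point[OF z', of xbar] dual_obj_dual_point[of E g ?y b' xbar] by simp
        moreover have "(\<Sum>\<beta>\<in>indices E. ?y \<beta>) = (\<Sum>\<beta>\<in>indices E. z' \<beta>) + t *\<^sub>R u"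
        proof -
          have "(\<Sum>\<beta>\<in>indices E. ?y \<beta>)
              = (\<Sum>\<beta>\<in>indices E. z' \<beta> + (if \<beta> = Inr \<alpha> then t *\<^sub>R u else 0))"
            by (intro sum.cong) auto
          then show ?thesis using \<alpha> S by (simp add: sum.distrib subset_iff)
        qed
        then have "residual E xbar ?y = ?r - t *\<^sub>R u"
          by (simp add: residual_def)
        ultimately have "(norm ?r)\<^sup>2 \<le> (norm (?r - t *\<^sub>R u))\<^sup>2"
          by (simp add: dual_value_def)
        then show ?thesis
          by (simp add: power2_norm_eq_inner inner_diff_left inner_diff_right inner_commute
              algebra_simps)
      qed
      note quad = this
      have "\<bar>2 * (?r \<bullet> u)\<bar> \<le> 0"
      proof (rule le_of_le_add_small_multiple[of _ _ "u \<bullet> u"])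
        fix t :: real assume "0 < t" "t < 1"
        then have "t * (2 * (?r \<bullet> u)) \<le> t * (t * (u \<bullet> u))" "t * - (2 * (?r \<bullet> u)) \<le> t * (t * (u \<bullet> u))"
          using quad[of t] quad[of "- t"] by (simp_all add: algebra_simps)
        then show "\<bar>2 * (?r \<bullet> u)\<bar> \<le> 0 + t * (u \<bullet> u)"
          using \<open>0 < t\<close> by (simp only: mult_le_cancel_left_pos)
      qed
      then show ?thesis by simp
    qed
    then have "?r \<in> (H \<alpha>)\<^sup>\<bottom>\<^sup>\<bottom>" by (simp add: mem_orthogonal_comp)
    then show ?thesis by (simp add: orthogonal_comp_self subspace_H)
  qed
  then show thesis using that[OF z' decrease] by blast
qed

section \<open>One inner step\<close>

lemma subgradient_stepD:
  assumes step: "inner_step E xbar f S g z g' z'" and S: "S \<subseteq> vertices"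
  shows "Inl i \<in> S \<Longrightarrow> subgradient_update (f i) ((xbar - vH E z) $ i) (g i) (z (Inl i) $ i)
             (g' i) (z' (Inl i) $ i) \<and> (\<forall>j. j \<noteq> i \<longrightarrow> z' (Inl i) $ j = 0)"
    and "Inl i \<notin> S \<Longrightarrow> g' i = g i"
    and "\<alpha> \<in> indices E - S \<Longrightarrow> z' \<alpha> = z \<alpha>"
  using step S unfolding inner_step_def by meson+

text \<open>After a step on a set of vertices the conjugates at these vertices are finite, even if they were
infinite before. This is what makes the dual value finite from the end of the first cycle on.\<close>
lemma subgradient_step_dual_point:
  fixes E :: "'v::finite set set" and S :: "('v, 'm::finite) idx set"
  assumes step: "inner_step E xbar f S g z g' z'" and S: "S \<subseteq> vertices"
    and minor: "\<And>i. convex_minorant (g i) (f i)"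
    and vertex: "\<And>i. Inl i \<notin> S \<Longrightarrow> (\<forall>j. j \<noteq> i \<longrightarrow> z (Inl i) $ j = 0) \<and>
          (\<exists>b. fenchel_conj (\<lambda>x. ereal (g i x)) (z (Inl i) $ i) = ereal b)"
    and edge: "\<And>\<alpha>. \<alpha> \<in> Ebar E \<Longrightarrow> z (Inr \<alpha>) \<in> (H \<alpha>)\<^sup>\<bottom>"
  obtains b' where "dual_point E g' z' b'" and "\<And>i. convex_minorant (g' i) (f i)"
proof -
  note upd = subgradient_stepD[OF step S]
  have "convex_minorant (g' i) (f i) \<and> (\<forall>j. j \<noteq> i \<longrightarrow> z' (Inl i) $ j = 0) \<and>
      (\<exists>b. fenchel_conj (\<lambda>x. ereal (g' i x)) (z' (Inl i) $ i) = ereal b)" for i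
  proof (cases "Inl i \<in> S")
    case True
    then show ?thesis
      using upd(1)[of i] subgradient_update_minorant[OF _ minor[of i]] by blast
  next
    case False
    then have "z' (Inl i) = z (Inl i)" by (intro upd(3)) (simp add: indices_def)
    then show ?thesis using False upd(2)[of i] vertex[OF False] minor[of i] by simp
  qed
  then obtain b' where b': "\<And>i. convex_minorant (g' i) (f i) \<and>
      (\<forall>j. j \<noteq> i \<longrightarrow> z' (Inl i) $ j = 0) \<and>
      fenchel_conj (\<lambda>x. ereal (g' i x)) (z' (Inl i) $ i) = ereal (b' i)" by metis
  moreover have "z' (Inr \<alpha>) \<in> (H \<alpha>)\<^sup>\<bottom>" if "\<alpha> \<in> Ebar E" for \<alpha>
  proof -
    have "z' (Inr \<alpha>) = z (Inr \<alpha>)" by (rule upd(3)) (use that S in \<open>auto simp: indices_def\<close>)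
    then show ?thesis using edge[OF that] by simp
  qed
  ultimately show thesis using that[of b'] by (simp add: dual_point_def)
qed

lemma subgradient_step_vH:
  fixes E :: "'v::finite set set" and S :: "('v, 'm::finite) idx set"
  assumes "inner_step E xbar f S g z g' z'" "S \<subseteq> vertices"
  shows "vH E z' = vH E z"
proof -
  have "z' (Inr \<alpha>) = z (Inr \<alpha>)" if "\<alpha> \<in> Ebar E" for \<alpha>
    by (rule subgradient_stepD(3)[OF assms]) (use assms(2) that in \<open>auto simp: indices_def\<close>)
  then show ?thesis by (simp add: vH_def)
qed

lemma dual_point_residual_nth:
  assumes "dual_point E g z b"
  shows "residual E xbar z $ i = (xbar - vH E z) $ i - z (Inl i) $ i"
  using assms by (intro residual_nth) (simp add: dual_point_def)

lemma subgradient_step_decrease: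
  fixes E :: "'v::finite set set" and S :: "('v, 'm::finite) idx set"
  assumes step: "inner_step E xbar f S g z g' z'" and S: "S \<subseteq> vertices"
    and z: "dual_point E g z b" and z': "dual_point E g' z' b'"
  shows "dual_value E xbar z' b'
      \<le> dual_value E xbar z b - 1/2 * (norm (residual E xbar z' - residual E xbar z))\<^sup>2"
proof -
  let ?r' = "residual E xbar z'" and ?r = "residual E xbar z"
  have vH: "vH E z' = vH E z" by (rule subgradient_step_vH[OF step S])
  have "1/2 * (norm (?r' $ i))\<^sup>2 + b' i
      \<le> 1/2 * (norm (?r $ i))\<^sup>2 + b i - 1/2 * (norm ((?r' - ?r) $ i))\<^sup>2" for i
  proof (cases "Inl i \<in> S")
    case True
    define c where "c = (xbar - vH E z) $ i"
    have upd: "subgradient_update (f i) c (g i) (z (Inl i) $ i) (g' i) (z' (Inl i) $ i)"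
      using subgradient_stepD(1)[OF step S True] by (simp only: c_def)
    have b: "fenchel_conj (\<lambda>x. ereal (g i x)) (z (Inl i) $ i) = ereal (b i)"
      "fenchel_conj (\<lambda>x. ereal (g' i x)) (z' (Inl i) $ i) = ereal (b' i)"
      using z z' by (simp_all add: dual_point_def)
    have r: "?r $ i = c - z (Inl i) $ i" "?r' $ i = c - z' (Inl i) $ i"
      using dual_point_residual_nth[OF z] dual_point_residual_nth[OF z'] vH
      by (simp_all add: c_def)
    have "(?r' - ?r) $ i = - (z' (Inl i) $ i - z (Inl i) $ i)"
      by (simp add: r)
    then have n: "norm ((?r' - ?r) $ i) = norm (z' (Inl i) $ i - z (Inl i) $ i)"
      by (simp only: norm_minus_cancel)
    show ?thesis
      unfolding n unfolding r
      by (rule subgradient_update_decrease[OF upd b]) linarith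
  next
    case False
    then have "z' (Inl i) = z (Inl i)" "g' i = g i"
      using subgradient_stepD(2,3)[OF step S] by (auto simp: indices_def)
    moreover from this have "b' i = b i"
      using z z' by (simp add: dual_point_def) (metis ereal.inject)
    ultimately show ?thesis
      using dual_point_residual_nth[OF z] dual_point_residual_nth[OF z'] vH by simp
  qed
  then have "dual_value E xbar z' b'
      \<le> (\<Sum>i\<in>UNIV. 1/2 * (norm (?r $ i))\<^sup>2 + b i - 1/2 * (norm ((?r' - ?r) $ i))\<^sup>2)"
    unfolding dual_value_eq_sum by (intro sum_mono)
  then show ?thesis
    by (simp add: sum_subtractf dual_value_eq_sum norm_vec_power2[of "?r' - ?r"]
        sum_distrib_left)
qed

text \<open>The error of the current affine minorants, measured at the current residual.\<close>
definition minorant_gap ::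
  "'v::finite set set \<Rightarrow> real ^ 'm::finite ^ 'v \<Rightarrow> ('v \<Rightarrow> real ^ 'm \<Rightarrow> real)
    \<Rightarrow> (('v, 'm) idx \<Rightarrow> real ^ 'm ^ 'v) \<Rightarrow> ('v \<Rightarrow> real) \<Rightarrow> real" where
  "minorant_gap E xbar f z b =
     (\<Sum>i\<in>UNIV. f i (residual E xbar z $ i) - (z (Inl i) $ i \<bullet> residual E xbar z $ i - b i))"

lemma subgradient_step_decrease_gap:
  fixes E :: "'v::finite set set" and xbar :: "real ^ 'm::finite ^ 'v"
  assumes step: "inner_step E xbar f vertices g z g' z'"
    and minor: "\<And>i. convex_minorant (g i) (f i)"
    and z: "dual_point E g z b" and z': "dual_point E g' z' b'"
    and f: "\<And>i. convex_on UNIV (f i)" "\<sigma> > 0"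
      "\<And>i. strongly_convex \<sigma> (fenchel_conj (\<lambda>x. ereal (f i x)))"
  shows "dual_value E xbar z' b'
      \<le> dual_value E xbar z b - min 1 (\<sigma> / 2) / 2 * minorant_gap E xbar f z b"
proof -
  let ?r' = "residual E xbar z'" and ?r = "residual E xbar z"
  have vH: "vH E z' = vH E z" by (rule subgradient_step_vH[OF step]) simp
  have "1/2 * (norm (?r' $ i))\<^sup>2 + b' i
      \<le> 1/2 * (norm (?r $ i))\<^sup>2 + b i
        - min 1 (\<sigma> / 2) / 2 * (f i (?r $ i) - (z (Inl i) $ i \<bullet> ?r $ i - b i))" for i
  proof -
    define c where "c = (xbar - vH E z) $ i"
    have upd: "subgradient_update (f i) c (g i) (z (Inl i) $ i) (g' i) (z' (Inl i) $ i)"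
      using subgradient_stepD(1)[OF step] by (simp only: c_def) simp
    have b: "fenchel_conj (\<lambda>x. ereal (g i x)) (z (Inl i) $ i) = ereal (b i)"
      "fenchel_conj (\<lambda>x. ereal (g' i x)) (z' (Inl i) $ i) = ereal (b' i)"
      using z z' by (simp_all add: dual_point_def)
    have r: "?r $ i = c - z (Inl i) $ i" "?r' $ i = c - z' (Inl i) $ i"
      using dual_point_residual_nth[OF z] dual_point_residual_nth[OF z'] vH
      by (simp_all add: c_def)
    show ?thesis
      unfolding r using subgradient_update_decrease_gap[OF upd minor b f] .
  qed
  then have "dual_value E xbar z' b'
      \<le> (\<Sum>i\<in>UNIV. 1/2 * (norm (?r $ i))\<^sup>2 + b i
        - min 1 (\<sigma> / 2) / 2 * (f i (?r $ i) - (z (Inl i) $ i \<bullet> ?r $ i - b i)))"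
    unfolding dual_value_eq_sum by (intro sum_mono)
  then show ?thesis
    unfolding dual_value_eq_sum[of E xbar z b] minorant_gap_def sum_distrib_left
    by (simp only: sum_subtractf)
qed

lemma inner_step_decrease:
  fixes E :: "'v::finite set set" and S :: "('v, 'm::finite) idx set"
  assumes step: "inner_step E xbar f S g z g' z'" and S: "S \<subseteq> indices E"
    and minor: "\<And>i. convex_minorant (g i) (f i)" and z: "dual_point E g z b"
  obtains b' where "dual_point E g' z' b'" and "\<And>i. convex_minorant (g' i) (f i)"
    and "dual_value E xbar z' b'
      \<le> dual_value E xbar z b - 1/2 * (norm (residual E xbar z' - residual E xbar z))\<^sup>2"
    and "\<And>\<alpha>. Inr \<alpha> \<in> S \<Longrightarrow> residual E xbar z' \<in> H \<alpha>"
proof (cases "S \<subseteq> vertices")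
  case True
  obtain b' where b': "dual_point E g' z' b'" "\<And>i. convex_minorant (g' i) (f i)"
  proof (rule subgradient_step_dual_point[OF step True minor])
    show "(\<forall>j. j \<noteq> i \<longrightarrow> z (Inl i) $ j = 0) \<and>
          (\<exists>b. fenchel_conj (\<lambda>x. ereal (g i x)) (z (Inl i) $ i) = ereal b)" for i
      using z by (auto simp: dual_point_def)
    show "z (Inr \<alpha>) \<in> (H \<alpha>)\<^sup>\<bottom>" if "\<alpha> \<in> Ebar E" for \<alpha>
      using z that by (simp add: dual_point_def)
  qed blast
  show thesis
    using that[OF b' subgradient_step_decrease[OF step True z b'(1)]] True by blast
next
  case False
  then have "g' = g" "z' minimizes block_obj E xbar g S z"
    "\<And>\<alpha>. \<alpha> \<in> indices E - S \<Longrightarrow> z' \<alpha> = z \<alpha>"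
    using step by (auto simp: inner_step_def)
  then show thesis
    using block_minimizer_step[of z' E xbar g S z b] S z minor that by metis
qed

section \<open>Weak duality and the primal-dual gap\<close>

text \<open>The left-hand side is the primal objective at \<open>x\<close> with the sign and the constant \<open>1/2 * (norm xbar)\<^sup>2\<close>
that turn the Fenchel dual into a minimization problem. For \<open>f\<close> the given functions it bounds the
optimal dual value from below.\<close>
lemma weak_duality:
  fixes E :: "'v::finite set set" and xbar x :: "real ^ 'm::finite ^ 'v"
  assumes "x \<in> D E"
  shows "ereal (1/2 * (norm xbar)\<^sup>2 - 1/2 * (norm (x - xbar))\<^sup>2 - (\<Sum>i\<in>UNIV. f i (x $ i)))
    \<le> dual_obj E xbar f z"
proof -
  let ?r = "residual E xbar z"
  have "(\<Sum>i\<in>UNIV. ereal (z (Inl i) \<bullet> x - f i (x $ i)))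
      \<le> (\<Sum>i\<in>UNIV. fenchel_conj (bold f (Inl i)) (z (Inl i)))"
    using fenchel_young[of _ x "bold f (Inl _)"] by (intro sum_mono) simp
  moreover have "(\<Sum>\<alpha>\<in>Ebar E. ereal (z (Inr \<alpha>) \<bullet> x))
      \<le> (\<Sum>\<alpha>\<in>Ebar E. fenchel_conj (indicator_fun (H \<alpha>)) (z (Inr \<alpha>)))"
  proof (rule sum_mono)
    fix \<alpha> :: "'v set \<times> 'm" assume "\<alpha> \<in> Ebar E"
    then have "x \<in> H \<alpha>" using assms by (auto simp: D_def)
    then show "ereal (z (Inr \<alpha>) \<bullet> x) \<le> fenchel_conj (indicator_fun (H \<alpha>)) (z (Inr \<alpha>))"
      using fenchel_young[of "z (Inr \<alpha>)" x "indicator_fun (H \<alpha>)"]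
      by (simp add: indicator_fun_def)
  qed
  ultimately have "ereal ((\<Sum>i\<in>UNIV. z (Inl i) \<bullet> x - f i (x $ i)) + (\<Sum>\<alpha>\<in>Ebar E. z (Inr \<alpha>) \<bullet> x)
      + 1/2 * (norm ?r)\<^sup>2) \<le> dual_obj E xbar f z"
    unfolding dual_obj_def residual_def plus_ereal.simps(1)[symmetric] sum_ereal[symmetric]
    by (intro add_mono order_refl)
  moreover have "(\<Sum>i\<in>UNIV. z (Inl i) \<bullet> x) + (\<Sum>\<alpha>\<in>Ebar E. z (Inr \<alpha>) \<bullet> x) = (xbar - ?r) \<bullet> x"
    by (simp add: residual_def sum_indices inner_add_left inner_sum_left)
  moreover have "1/2 * (norm xbar)\<^sup>2 - 1/2 * (norm (x - xbar))\<^sup>2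
      \<le> (xbar - ?r) \<bullet> x + 1/2 * (norm ?r)\<^sup>2"
  proof -
    have "0 \<le> (norm (?r - x))\<^sup>2" by simp
    then show ?thesis
      by (simp add: power2_norm_eq_inner inner_diff_left inner_diff_right inner_commute
          diff_divide_distrib add_divide_distrib)
  qed
  ultimately show ?thesis
    by (simp add: sum_subtractf) (erule order_trans[rotated], simp)
qed

text \<open>All linear terms cancel because the edge variables are orthogonal to \<open>x \<in> D E\<close>; what remains is the
error of the affine minorants at \<open>x\<close> and the distance from \<open>x\<close> to the residual.\<close>
lemma primal_dual_gap:
  fixes E :: "'v::finite set set" and xbar x :: "real ^ 'm::finite ^ 'v"
  assumes z: "dual_point E g z b" and x: "x \<in> D E"
  shows "dual_value E xbar z b
      - (1/2 * (norm xbar)\<^sup>2 - 1/2 * (norm (x - xbar))\<^sup>2 - (\<Sum>i\<in>UNIV. f i (x $ i)))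
    = (\<Sum>i\<in>UNIV. f i (x $ i) - (z (Inl i) $ i \<bullet> x $ i - b i))
      + 1/2 * (norm (x - residual E xbar z))\<^sup>2"
proof -
  let ?r = "residual E xbar z"
  have "z (Inr \<alpha>) \<bullet> x = 0" if "\<alpha> \<in> Ebar E" for \<alpha>
    using z x that by (auto simp: dual_point_def mem_orthogonal_comp D_def)
  then have "(\<Sum>\<alpha>\<in>Ebar E. z (Inr \<alpha>) \<bullet> x) = 0" by simp
  moreover have "z (Inl i) \<bullet> x = z (Inl i) $ i \<bullet> x $ i" for i
    using z by (intro inner_supported_at) (simp add: dual_point_def)
  ultimately have "(xbar - ?r) \<bullet> x = (\<Sum>i\<in>UNIV. z (Inl i) $ i \<bullet> x $ i)"
    by (simp add: residual_def sum_indices inner_add_left inner_sum_left)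
  then show ?thesis
    unfolding dual_value_def
    by (simp add: sum_subtractf sum.distrib power2_norm_eq_inner inner_diff_left inner_diff_right
        inner_commute algebra_simps)
qed

section \<open>Distance to the consensus subspace\<close>

text \<open>Regularity as an error bound. Let \<open>v\<close> be the component of \<open>x\<close> orthogonal to \<open>D E\<close> and decompose it into
\<open>u \<alpha> \<in> (H \<alpha>)\<^sup>\<bottom>\<close> with norms of order \<open>norm v\<close>. Each \<open>u \<alpha>\<close> only sees the distance of \<open>x\<close> to \<open>H \<alpha>\<close>, so
\<open>v \<bullet> v\<close> is at most of order \<open>norm v * M\<close>.\<close>
lemma near_consensus:
  fixes E :: "'v::finite set set" and E' :: "('v set \<times> 'm::finite) set" and x :: "real ^ 'm ^ 'v"
  assumes reg: "regularity_const TYPE('v set \<times> 'm) E C" and E': "connects E E'"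
    and near: "\<And>\<alpha>. \<alpha> \<in> E' \<Longrightarrow> \<exists>y\<in>H \<alpha>. norm (x - y) \<le> M" and "0 \<le> M"
  obtains p where "p \<in> D E"
    and "norm (x - p) \<le> real (card (Ebar E :: ('v set \<times> 'm) set)) * C * M"
proof -
  obtain p v where p: "p \<in> span (D E)" and v: "\<And>w. w \<in> span (D E) \<Longrightarrow> orthogonal v w"
    and xpv: "x = p + v"
    using orthogonal_subspace_decomp_exists[of "D E" x] by metis
  have span: "span (D E) = (D E :: (real ^ 'm ^ 'v) set)"
    using subspace_D span_eq_iff by blast
  have "v \<in> (D E)\<^sup>\<bottom>" using v by (simp add: span mem_orthogonal_comp orthogonal_def)
  then obtain u where vu: "v = (\<Sum>\<alpha>\<in>E'. u \<alpha>)"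
    and u: "\<And>\<alpha>. \<alpha> \<in> E' \<Longrightarrow> u \<alpha> \<in> (H \<alpha>)\<^sup>\<bottom> \<and> norm (u \<alpha>) \<le> C * norm v"
    using reg E' unfolding regularity_const_def by blast
  have C: "C > 0" using reg by (simp add: regularity_const_def)
  have sub: "E' \<subseteq> Ebar E" using E' by (simp add: connects_def)
  have "u \<alpha> \<bullet> v \<le> C * norm v * M" if \<alpha>: "\<alpha> \<in> E'" for \<alpha>
  proof -
    obtain y where y: "y \<in> H \<alpha>" "norm (x - y) \<le> M" using near[OF \<alpha>] by blast
    have "p \<in> D E" using p by (simp only: span)
    then have "p \<in> H \<alpha>" using \<alpha> sub by (auto simp: D_def)
    then have "u \<alpha> \<bullet> v = u \<alpha> \<bullet> (x - y)"
      using u[OF \<alpha>] y(1) by (simp add: mem_orthogonal_comp xpv inner_diff_right inner_add_right)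
    also have "\<dots> \<le> norm (u \<alpha>) * norm (x - y)" by (rule norm_cauchy_schwarz)
    also have "\<dots> \<le> (C * norm v) * M" using u[OF \<alpha>] y(2) C by (intro mult_mono) auto
    finally show ?thesis .
  qed
  then have "(\<Sum>\<alpha>\<in>E'. u \<alpha> \<bullet> v) \<le> (\<Sum>\<alpha>\<in>E'. C * norm v * M)" by (rule sum_mono)
  then have "(norm v)\<^sup>2 \<le> real (card E') * (C * norm v * M)"
    by (simp add: power2_norm_eq_inner vu[symmetric] flip: inner_sum_left)
  also have "\<dots> \<le> real (card (Ebar E :: ('v set \<times> 'm) set)) * (C * norm v * M)"
    using C \<open>0 \<le> M\<close> card_mono[OF _ sub] by (intro mult_right_mono) auto
  finally have *: "norm v * norm v \<le> norm v * (real (card (Ebar E :: ('v set \<times> 'm) set)) * C * M)"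
    by (simp add: power2_eq_square algebra_simps)
  have "norm v \<le> real (card (Ebar E :: ('v set \<times> 'm) set)) * C * M"
  proof (cases "v = 0")
    case True
    then show ?thesis using C \<open>0 \<le> M\<close> by simp
  next
    case False
    then have "0 < norm v" by simp
    then show ?thesis using * by (rule mult_left_le_imp_le[rotated])
  qed
  then show thesis using that[of p] p span xpv by simp
qed

section \<open>One cycle\<close>

text \<open>The heart of the matter: the gap at the start of a cycle, bounded through weak duality by a feasible
point \<open>p\<close> near the residual, is at most a constant times the decrease \<open>\<Delta>\<close> over the cycle. The first
summand of the constant comes from the error of the minorants, which the first step of the cycle
converts into decrease; the second comes from the distance of the residual to \<open>D E\<close>, which the
treatment of the edge constraints during the cycle keeps of order \<open>sqrt \<Delta>\<close>.\<close>
lemma cycle_gap: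
  fixes E :: "'v::finite set set" and xbar :: "real ^ 'm::finite ^ 'v"
    and S :: "nat \<Rightarrow> ('v, 'm) idx set" and E' :: "('v set \<times> 'm) set"
  assumes steps: "\<And>w. w \<in> {1..wbar} \<Longrightarrow>
      S w \<subseteq> indices E \<and> inner_step E xbar f (S w) (g (w - 1)) (z (w - 1)) (g w) (z w)"
    and "wbar > 0" and first: "S 1 = vertices"
    and minor: "\<And>i. convex_minorant (g 0 i) (f i)"
    and b0: "dual_point E (g 0) (z 0) b0"
    and f: "\<And>i. convex_on UNIV (f i)" "\<sigma> > 0"
      "\<And>i. strongly_convex \<sigma> (fenchel_conj (\<lambda>x. ereal (f i x)))"
    and reg: "regularity_const TYPE('v set \<times> 'm) E C" and E': "connects E E'"
    and treated: "\<And>\<alpha>. \<alpha> \<in> E' \<Longrightarrow> \<exists>w\<in>{1..wbar}. Inr \<alpha> \<in> S w"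
  obtains b' p where "dual_point E (g wbar) (z wbar) b'" and "p \<in> D E"
    and "dual_value E xbar (z wbar) b' \<le> dual_value E xbar (z 0) b0"
    and "dual_value E xbar (z 0) b0
        - (1/2 * (norm xbar)\<^sup>2 - 1/2 * (norm (p - xbar))\<^sup>2 - (\<Sum>i\<in>UNIV. f i (p $ i)))
      \<le> ((1 + 1 / \<sigma>) * (2 / min 1 (\<sigma> / 2))
          + (1 + 1 / (2 * \<sigma>)) * 2 * (real (card (Ebar E :: ('v set \<times> 'm) set)) * C * real wbar)\<^sup>2)
        * (dual_value E xbar (z 0) b0 - dual_value E xbar (z wbar) b')"
proof -
  let ?r = "\<lambda>w. residual E xbar (z w)"
  let ?P = "\<lambda>w b. (w = 0 \<longrightarrow> b = b0) \<and>
    (w \<le> wbar \<longrightarrow> dual_point E (g w) (z w) b \<and> (\<forall>i. convex_minorant (g w i) (f i)))"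
  let ?Q = "\<lambda>w b b'. w < wbar \<longrightarrow>
    dual_value E xbar (z (Suc w)) b'
      \<le> dual_value E xbar (z w) b - 1/2 * (norm (?r (Suc w) - ?r w))\<^sup>2 \<and>
    (\<forall>\<alpha>. Inr \<alpha> \<in> S (Suc w) \<longrightarrow> ?r (Suc w) \<in> H \<alpha>)"
  have "\<exists>b. \<forall>w. ?P w (b w) \<and> ?Q w (b w) (b (Suc w))"
  proof (rule dependent_nat_choice)
    show "\<exists>b. ?P 0 b" using b0 minor by blast
    fix b w assume P: "?P w b"
    show "\<exists>b'. ?P (Suc w) b' \<and> ?Q w b b'"
    proof (cases "w < wbar")
      case False
      then show ?thesis by auto
    next
      case True
      then have "S (Suc w) \<subseteq> indices E"
        "inner_step E xbar f (S (Suc w)) (g w) (z w) (g (Suc w)) (z (Suc w))"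
        using steps[of "Suc w"] by auto
      moreover have "dual_point E (g w) (z w) b" "\<And>i. convex_minorant (g w i) (f i)"
        using P True by auto
      ultimately show ?thesis
        by (elim inner_step_decrease[of E xbar f "S (Suc w)"]) auto
    qed
  qed
  then obtain b where b: "\<And>w. ?P w (b w)" and step: "\<And>w. ?Q w (b w) (b (Suc w))" by blast
  have b_0: "b 0 = b0" using b[of 0] by simp
  define val where "val w = dual_value E xbar (z w) (b w)" for w
  have val_step: "val (Suc w) \<le> val w - 1/2 * (norm (?r (Suc w) - ?r w))\<^sup>2" if "w < wbar" for w
    using step[of w] that by (simp add: val_def)
  have mono: "val w \<le> val v" if "v \<le> w" "w \<le> wbar" for v w
    using that
  proof (induction w rule: dec_induct)
    case (step w)
    have "0 \<le> 1/2 * (norm (?r (Suc w) - ?r w))\<^sup>2" by simp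
    then show ?case using val_step[of w] step by linarith
  qed simp
  define \<Delta> where "\<Delta> = val 0 - val wbar"
  have "\<Delta> \<ge> 0" using mono[of 0 wbar] by (simp add: \<Delta>_def)
  have move: "norm (?r 0 - ?r w) \<le> real w * sqrt (2 * \<Delta>)" if "w \<le> wbar" for w
    using that
  proof (induction w)
    case (Suc w)
    have "(norm (?r (Suc w) - ?r w))\<^sup>2 \<le> 2 * \<Delta>"
      using val_step[of w] mono[of 0 w] mono[of "Suc w" wbar] Suc.prems by (simp add: \<Delta>_def)
    then have "norm (?r (Suc w) - ?r w) \<le> sqrt (2 * \<Delta>)" by (rule real_le_rsqrt)
    moreover have "norm (?r 0 - ?r (Suc w)) \<le> norm (?r 0 - ?r w) + norm (?r (Suc w) - ?r w)"
      using norm_triangle_ineq4[of "?r 0 - ?r w" "?r (Suc w) - ?r w"] by simp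
    ultimately show ?case using Suc by (simp add: algebra_simps)
  qed simp
  let ?N = "real (card (Ebar E :: ('v set \<times> 'm) set))"
  obtain p where p: "p \<in> D E" and dist: "norm (?r 0 - p) \<le> ?N * C * (real wbar * sqrt (2 * \<Delta>))"
  proof (rule near_consensus[OF reg E', of "?r 0" "real wbar * sqrt (2 * \<Delta>)"])
    fix \<alpha> assume "\<alpha> \<in> E'"
    then obtain w where w: "w \<in> {1..wbar}" "Inr \<alpha> \<in> S w" using treated by blast
    then have "?r w \<in> H \<alpha>" using step[of "w - 1"] by (cases \<alpha>) auto
    moreover have "real w * sqrt (2 * \<Delta>) \<le> real wbar * sqrt (2 * \<Delta>)"
      using w \<open>\<Delta> \<ge> 0\<close> by (intro mult_right_mono) auto
    then have "norm (?r 0 - ?r w) \<le> real wbar * sqrt (2 * \<Delta>)"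
      using move[of w] w by auto
    ultimately show "\<exists>y\<in>H \<alpha>. norm (?r 0 - y) \<le> real wbar * sqrt (2 * \<Delta>)" by blast
  qed (use \<open>\<Delta> \<ge> 0\<close> in auto)
  have "(norm (p - ?r 0))\<^sup>2 \<le> (?N * C * (real wbar * sqrt (2 * \<Delta>)))\<^sup>2"
    using dist by (intro power_mono) (simp_all add: norm_minus_commute)
  also have "\<dots> = 2 * (?N * C * real wbar)\<^sup>2 * \<Delta>"
    using \<open>\<Delta> \<ge> 0\<close> by (simp add: power_mult_distrib)
  finally have near: "(norm (p - ?r 0))\<^sup>2 \<le> 2 * (?N * C * real wbar)\<^sup>2 * \<Delta>" .
  define G where "G = minorant_gap E xbar f (z 0) b0"
  define \<kappa> where "\<kappa> = min 1 (\<sigma> / 2) / 2"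
  have "\<kappa> > 0" using f(2) by (simp add: \<kappa>_def)
  have "val 1 \<le> val 0 - \<kappa> * G"
    unfolding val_def b_0 \<kappa>_def G_def
  proof (rule subgradient_step_decrease_gap[OF _ _ b0 _ f])
    show "inner_step E xbar f vertices (g 0) (z 0) (g 1) (z 1)"
      using steps[of 1] first \<open>wbar > 0\<close> by auto
    show "dual_point E (g 1) (z 1) (b 1)" using b[of 1] \<open>wbar > 0\<close> by simp
  qed (rule minor)
  then have "\<kappa> * G \<le> \<Delta>" using mono[of 1 wbar] \<open>wbar > 0\<close> by (simp add: \<Delta>_def)
  then have G: "G \<le> 2 / min 1 (\<sigma> / 2) * \<Delta>"
    using \<open>\<kappa> > 0\<close> by (simp add: \<kappa>_def field_simps)
  have pointwise: "f i (p $ i) - (z 0 (Inl i) $ i \<bullet> p $ i - b0 i)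
      \<le> (1 + 1 / \<sigma>) * (f i (?r 0 $ i) - (z 0 (Inl i) $ i \<bullet> ?r 0 $ i - b0 i))
        + (1/2 + 1 / (2 * \<sigma>)) * (norm ((p - ?r 0) $ i))\<^sup>2" for i
  proof -
    obtain s where s: "s \<in> subdifferential (f i) (?r 0 $ i)"
      using convex_real_has_subgradient[OF f(1)] .
    have "z 0 (Inl i) $ i \<bullet> x - b0 i \<le> f i x" for x
    proof -
      have "z 0 (Inl i) $ i \<bullet> x - g 0 i x \<le> b0 i"
        using b0 fenchel_conj_le_iff[of "g 0 i" "z 0 (Inl i) $ i" "b0 i"]
        by (simp add: dual_point_def)
      moreover have "g 0 i x \<le> f i x" using minor by (simp add: convex_minorant_def)
      ultimately show ?thesis by linarith
    qed
    from affine_minorant_gap_bound[OF strongly_convex_conj_descent[OF f(1) f(2) f(3) s] f(2) this]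
    show ?thesis by simp
  qed
  have "(\<Sum>i\<in>UNIV. f i (p $ i) - (z 0 (Inl i) $ i \<bullet> p $ i - b0 i))
      \<le> (\<Sum>i\<in>UNIV. (1 + 1 / \<sigma>) * (f i (?r 0 $ i) - (z 0 (Inl i) $ i \<bullet> ?r 0 $ i - b0 i))
        + (1/2 + 1 / (2 * \<sigma>)) * (norm ((p - ?r 0) $ i))\<^sup>2)"
    using pointwise by (rule sum_mono)
  also have "\<dots> = (1 + 1 / \<sigma>) * G + (1/2 + 1 / (2 * \<sigma>)) * (norm (p - ?r 0))\<^sup>2"
    unfolding G_def minorant_gap_def norm_vec_power2[of "p - ?r 0"] sum_distrib_left
    by (rule sum.distrib)
  finally have "val 0 - (1/2 * (norm xbar)\<^sup>2 - 1/2 * (norm (p - xbar))\<^sup>2 - (\<Sum>i\<in>UNIV. f i (p $ i)))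
      \<le> (1 + 1 / \<sigma>) * G + (1/2 + 1 / (2 * \<sigma>)) * (norm (p - ?r 0))\<^sup>2 + 1/2 * (norm (p - ?r 0))\<^sup>2"
    unfolding val_def b_0 primal_dual_gap[OF b0 p] by simp
  also have "\<dots> = (1 + 1 / \<sigma>) * G + (1 + 1 / (2 * \<sigma>)) * (norm (p - ?r 0))\<^sup>2"
    by (simp add: algebra_simps)
  also have "\<dots> \<le> (1 + 1 / \<sigma>) * (2 / min 1 (\<sigma> / 2) * \<Delta>)
      + (1 + 1 / (2 * \<sigma>)) * (2 * (?N * C * real wbar)\<^sup>2 * \<Delta>)"
    using f(2) G near by (intro add_mono mult_left_mono) auto
  also have "\<dots> = ((1 + 1 / \<sigma>) * (2 / min 1 (\<sigma> / 2))
      + (1 + 1 / (2 * \<sigma>)) * 2 * (?N * C * real wbar)\<^sup>2) * \<Delta>"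
    by (simp only: distrib_right mult.assoc)
  finally have "val 0 - (1/2 * (norm xbar)\<^sup>2 - 1/2 * (norm (p - xbar))\<^sup>2 - (\<Sum>i\<in>UNIV. f i (p $ i)))
      \<le> ((1 + 1 / \<sigma>) * (2 / min 1 (\<sigma> / 2))
      + (1 + 1 / (2 * \<sigma>)) * 2 * (?N * C * real wbar)\<^sup>2) * \<Delta>" .
  moreover have "dual_point E (g wbar) (z wbar) (b wbar)" using b[of wbar] by simp
  ultimately show thesis
    using that[of "b wbar" p] p \<open>\<Delta> \<ge> 0\<close> by (simp add: \<Delta>_def val_def b_0)
qed

lemma cycle_dual_point:
  fixes E :: "'v::finite set set" and xbar :: "real ^ 'm::finite ^ 'v"
    and S :: "nat \<Rightarrow> ('v, 'm) idx set"
  assumes steps: "\<And>w. w \<in> {1..wbar} \<Longrightarrow>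
      S w \<subseteq> indices E \<and> inner_step E xbar f (S w) (g (w - 1)) (z (w - 1)) (g w) (z w)"
    and "wbar > 0" and first: "S 1 = vertices"
    and minor: "\<And>i. convex_minorant (g 0 i) (f i)"
    and edge: "\<And>\<alpha>. \<alpha> \<in> Ebar E \<Longrightarrow> z 0 (Inr \<alpha>) \<in> (H \<alpha>)\<^sup>\<bottom>"
  shows "(\<forall>i. convex_minorant (g wbar i) (f i)) \<and> (\<exists>b. dual_point E (g wbar) (z wbar) b)"
proof -
  have "(\<forall>i. convex_minorant (g w i) (f i)) \<and> (\<exists>b. dual_point E (g w) (z w) b)"
    if "1 \<le> w" "w \<le> wbar" for w
    using that
  proof (induction w rule: dec_induct)
    case base
    have "inner_step E xbar f vertices (g 0) (z 0) (g 1) (z 1)"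
      using steps[of 1] first \<open>wbar > 0\<close> by auto
    from subgradient_step_dual_point[OF this _ minor _ edge] show ?case by blast
  next
    case (step w)
    then obtain b where "dual_point E (g w) (z w) b" "\<And>i. convex_minorant (g w i) (f i)" by auto
    moreover have "S (Suc w) \<subseteq> indices E"
      "inner_step E xbar f (S (Suc w)) (g w) (z w) (g (Suc w)) (z (Suc w))"
      using steps[of "Suc w"] step by auto
    ultimately show ?case
      by (elim inner_step_decrease[of E xbar f "S (Suc w)"]) auto
  qed
  then show ?thesis using \<open>wbar > 0\<close> by simp
qed

section \<open>Linear convergence\<close>

text \<open>Redistributing the edge variables between two cycles leaves their sum unchanged, and the dual objective
depends on them only through this sum.\<close>
lemma dual_point_redistribute:
  assumes "dual_point E g z b" and "\<And>i. z' (Inl i) = z (Inl i)" and "vH E z' = vH E z"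
    and "\<And>\<alpha>. \<alpha> \<in> Ebar E \<Longrightarrow> z' (Inr \<alpha>) \<in> (H \<alpha>)\<^sup>\<bottom>"
  shows "dual_point E g z' b" and "dual_value E xbar z' b = dual_value E xbar z b"
  using assms by (simp_all add: dual_point_def dual_value_def residual_def vH_def sum_indices)

lemma dual_obj_antimono:
  assumes "\<And>i x. g i x \<le> f i x"
  shows "dual_obj E xbar f z \<le> dual_obj E xbar g z"
proof -
  have "fenchel_conj (bold f (Inl i)) v \<le> fenchel_conj (bold g (Inl i)) v" for i v
    unfolding fenchel_conj_def using assms by (intro SUP_mono') (simp add: ereal_minus_mono)
  then show ?thesis
    unfolding dual_obj_def by (intro add_mono sum_mono order_refl)
qed

theorem theorem3p3:
  fixes E :: "'v::finite set set"
    and xbar :: "real ^ 'm::finite ^ 'v"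
    and f :: "'v \<Rightarrow> real ^ 'm \<Rightarrow> real"
    and \<sigma> Creg :: real
    and wbar :: nat
    and En :: "nat \<Rightarrow> ('v set \<times> 'm) set"
    and S :: "nat \<Rightarrow> nat \<Rightarrow> ('v, 'm) idx set"
    and z :: "nat \<Rightarrow> nat \<Rightarrow> ('v, 'm) idx \<Rightarrow> real ^ 'm ^ 'v"
    and g :: "nat \<Rightarrow> nat \<Rightarrow> 'v \<Rightarrow> real ^ 'm \<Rightarrow> real"
    and zstar :: "('v, 'm) idx \<Rightarrow> real ^ 'm ^ 'v"
  assumes "connected_ugraph E"
    and "\<And>i. convex_on UNIV (f i)"
    and "\<And>i. closed (epigraph UNIV (f i))"
    and "\<sigma> > 0"
    and "\<And>i. strongly_convex \<sigma> (fenchel_conj (\<lambda>x. ereal (f i x)))"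
    and "regularity_const TYPE('v set \<times> 'm) E Creg"
    and "wbar > 0"
    and "dykstra_run E xbar f Creg wbar En S z g"
    and "assumption_A1 E xbar wbar S z g"
    and "assumption_A2 wbar S"
    and "assumption_A3 S"
    and "\<And>n. n \<ge> 1 \<Longrightarrow> S n 1 = vertices"
    and "\<And>n. n \<ge> 1 \<Longrightarrow> (\<Union>w\<in>{1..wbar}. S n w) \<inter> Inr ` Ebar E = Inr ` En n"
    and "zstar minimizes dual_obj E xbar f"
  shows "\<exists>c\<in>{0<..<1}. \<forall>n\<ge>1.
      dual_obj E xbar (g (n + 1) 0) (z (n + 1) 0) - dual_obj E xbar f zstar
        \<le> ereal c * (dual_obj E xbar (g n 0) (z n 0) - dual_obj E xbar f zstar)"
proof -
  note f = assms(2) assms(4) assms(5) and reg = assms(6) and wbar = assms(7) and run = assms(8)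
    and first = assms(12) and treated = assms(13) and zstar = assms(14)
  have init: "convex_minorant (g 1 0 i) (f i)" for i
    using run by (simp add: dykstra_run_def convex_minorant_def)
  have cycle: "connects E (En n)" "\<And>\<alpha>. \<alpha> \<in> Ebar E \<Longrightarrow> z n 0 (Inr \<alpha>) \<in> (H \<alpha>)\<^sup>\<bottom>"
    "\<And>w. w \<in> {1..wbar} \<Longrightarrow> S n w \<subseteq> indices E \<and>
      inner_step E xbar f (S n w) (g n (w - 1)) (z n (w - 1)) (g n w) (z n w)"
    "\<And>i. z (n + 1) 0 (Inl i) = z n wbar (Inl i)" "vH E (z (n + 1) 0) = vH E (z n wbar)"
    "g (n + 1) 0 = g n wbar" if "n \<ge> 1" for n
  proof -
    have *: "connects E (En n) \<and>
       (\<forall>\<alpha>\<in>Ebar E. (\<alpha> \<notin> En n \<longrightarrow> z n 0 (Inr \<alpha>) = 0) \<and>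
          z n 0 (Inr \<alpha>) \<in> (H \<alpha>)\<^sup>\<bottom> \<and>
          norm (z n 0 (Inr \<alpha>)) \<le> Creg * norm (vH E (z n 0))) \<and>
       (\<forall>w\<in>{1..wbar}. S n w \<noteq> {} \<and> S n w \<subseteq> vertices \<union> Inr ` En n \<and>
          inner_step E xbar f (S n w) (g n (w - 1)) (z n (w - 1)) (g n w) (z n w)) \<and>
       (\<forall>i. z (n + 1) 0 (Inl i) = z n wbar (Inl i)) \<and>
       vH E (z (n + 1) 0) = vH E (z n wbar) \<and>
       g (n + 1) 0 = g n wbar"
      using run that unfolding dykstra_run_def by blast
    then have "vertices \<union> Inr ` En n \<subseteq> indices E"
      by (auto simp: connects_def indices_def)
    then show "\<And>w. w \<in> {1..wbar} \<Longrightarrow> S n w \<subseteq> indices E \<and>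
        inner_step E xbar f (S n w) (g n (w - 1)) (z n (w - 1)) (g n w) (z n w)"
      using * by blast
    show "connects E (En n)" "\<And>\<alpha>. \<alpha> \<in> Ebar E \<Longrightarrow> z n 0 (Inr \<alpha>) \<in> (H \<alpha>)\<^sup>\<bottom>"
      "\<And>i. z (n + 1) 0 (Inl i) = z n wbar (Inl i)" "vH E (z (n + 1) 0) = vH E (z n wbar)"
      "g (n + 1) 0 = g n wbar"
      using * by blast+
  qed
  have cycle_end: "(\<forall>i. convex_minorant (g n wbar i) (f i)) \<and> (\<exists>b. dual_point E (g n wbar) (z n wbar) b)"
    if "n \<ge> 1" "\<And>i. convex_minorant (g n 0 i) (f i)" for n
    using cycle_dual_point[of wbar "S n" E xbar f "g n" "z n"] cycle(2,3)[OF that(1)] wbar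
      first[OF that(1)] that(2) by blast
  have minor: "\<forall>i. convex_minorant (g n 0 i) (f i)" if "n \<ge> 1" for n
    using that
  proof (induction n rule: dec_induct)
    case (step n)
    then show ?case using cycle_end[of n] cycle(6)[of n] by simp
  qed (use init in simp)
  have next_point: "dual_point E (g (n + 1) 0) (z (n + 1) 0) b"
    "dual_value E xbar (z (n + 1) 0) b = dual_value E xbar (z n wbar) b"
    if "n \<ge> 1" "dual_point E (g n wbar) (z n wbar) b" for n b
    using dual_point_redistribute[OF that(2) cycle(4,5)[OF that(1)] cycle(2)[of "n + 1"]]
      cycle(6)[OF that(1)] by simp_all
  \<comment> \<open>The optimal value is finite: weak duality bounds it below, the second cycle's start above.\<close>
  obtain F where F: "dual_obj E xbar f zstar = ereal F"
  proof -
    obtain b where "dual_point E (g 1 wbar) (z 1 wbar) b" using cycle_end[of 1] init by auto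
    then have "dual_point E (g 2 0) (z 2 0) b" using next_point(1)[of 1 b] by (simp add: numeral_2_eq_2)
    from dual_obj_dual_point[OF this, of xbar]
    have "dual_obj E xbar (g 2 0) (z 2 0) \<noteq> \<infinity>" by simp
    moreover have "dual_obj E xbar f zstar \<le> dual_obj E xbar f (z 2 0)"
      using zstar by (simp add: minimizes_iff)
    moreover have "dual_obj E xbar f (z 2 0) \<le> dual_obj E xbar (g 2 0) (z 2 0)"
      by (rule dual_obj_antimono) (use minor[of 2] in \<open>simp add: convex_minorant_def\<close>)
    ultimately have "dual_obj E xbar f zstar \<noteq> \<infinity>" by auto
    moreover have "dual_obj E xbar f zstar \<noteq> - \<infinity>"
      using weak_duality[OF subspace_0[OF subspace_D], of xbar f E zstar] by auto
    ultimately show thesis using that by (cases "dual_obj E xbar f zstar") auto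
  qed
  define K where "K = (1 + 1 / \<sigma>) * (2 / min 1 (\<sigma> / 2))
          + (1 + 1 / (2 * \<sigma>)) * 2 * (real (card (Ebar E :: ('v set \<times> 'm) set)) * Creg * real wbar)\<^sup>2"
  have "K \<ge> 0" using f(2) unfolding K_def by (intro add_nonneg_nonneg mult_nonneg_nonneg) auto
  define c where "c = 1 - 1 / (K + 2)"
  have c: "0 < c" "c < 1" using \<open>K \<ge> 0\<close> by (simp_all add: c_def)
  have "dual_obj E xbar (g (n + 1) 0) (z (n + 1) 0) - dual_obj E xbar f zstar
        \<le> ereal c * (dual_obj E xbar (g n 0) (z n 0) - dual_obj E xbar f zstar)"
    if n: "n \<ge> 1" for n
  proof (cases "dual_obj E xbar (g n 0) (z n 0) = \<infinity>")
    case True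
    then show ?thesis using c by (simp add: F)
  next
    case False
    then obtain b where b: "dual_point E (g n 0) (z n 0) b" by (rule dual_point_of_finite)
    have tr: "\<exists>w\<in>{1..wbar}. Inr \<alpha> \<in> S n w" if "\<alpha> \<in> En n" for \<alpha>
      using treated[OF n] that by blast
    obtain b' p where b': "dual_point E (g n wbar) (z n wbar) b'" and p: "p \<in> D E"
      and dec: "dual_value E xbar (z n wbar) b' \<le> dual_value E xbar (z n 0) b"
      and gap: "dual_value E xbar (z n 0) b
        - (1/2 * (norm xbar)\<^sup>2 - 1/2 * (norm (p - xbar))\<^sup>2 - (\<Sum>i\<in>UNIV. f i (p $ i)))
      \<le> K * (dual_value E xbar (z n 0) b - dual_value E xbar (z n wbar) b')"
      using cycle_gap[of wbar "S n" E xbar f "g n" "z n" b \<sigma> Creg "En n", OF cycle(3)[OF n] wbar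
          first[OF n] minor[OF n, rule_format] b f reg cycle(1)[OF n] tr]
      unfolding K_def by blast
    let ?v = "dual_value E xbar (z n 0) b" and ?v' = "dual_value E xbar (z n wbar) b'"
    have "?v - F \<le> K * (?v - ?v')"
      using weak_duality[OF p, of xbar f zstar] gap by (simp add: F)
    \<comment> \<open>Enlarging \<open>K\<close> keeps the factor \<open>1 - 1 / (K + 2)\<close> strictly between \<open>0\<close> and \<open>1\<close>.\<close>
    also have "\<dots> \<le> (K + 2) * (?v - ?v')" using dec by (intro mult_right_mono) auto
    finally have "(?v - F) / (K + 2) \<le> ?v - ?v'"
      using \<open>K \<ge> 0\<close> by (simp add: field_simps)
    then have "?v' - F \<le> c * (?v - F)" by (simp add: c_def left_diff_distrib)
    moreover have "dual_obj E xbar (g (n + 1) 0) (z (n + 1) 0) = ereal ?v'"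
      using dual_obj_dual_point[OF next_point(1)[OF n b'], of xbar] next_point(2)[OF n b'] by simp
    ultimately show ?thesis
      by (simp add: F dual_obj_dual_point[OF b])
  qed
  then show ?thesis using c by (intro bexI[of _ c]) auto
qed

end
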